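(* Fix any ordinal $1\leq\xi\leq\omega_1$. For $1\leq q<p\leq\infty$, the norm-closed operator ideals $\overline{\mathcal{WD}}_{\ell_p}^{(\infty,\xi)}$ and $\overline{\mathcal{WD}}_{\ell_q}^{(\infty,\xi)}$ are distinct as classes; that is, there exist Banach spaces $X$ and $Y$ such that $\overline{\mathcal{WD}}_{\ell_p}^{(\infty,\xi)}(X,Y)\neq\overline{\mathcal{WD}}_{\ell_q}^{(\infty,\xi)}(X,Y)$.
   Context: All Banach spaces are over a fixed scalar field ($\mathbb{R}$ or $\mathbb{C}$); $\mathcal{L}(X,Y)$ is the space of continuous linear operators $X\to Y$ with the operator norm; $c_{00}$ is the space of finitely supported scalar sequences; $\omega_1$ is the first uncountable ordinal. For finite $E,F\subset\mathbb{N}$, $E<F$ means $\max E<\min F$, and $n\leq F$ means $n\leq\min F$. Schreier families: $\mathcal{S}_0:=\{\{n\}:n\in\mathbb{N}\}\cup\{\emptyset\}$ and $\mathcal{S}_1:=\{F\subset\mathbb{N}:\#F\leq\min F\}\cup\{\emptyset\}$. If $\xi=\zeta+1$ with $1\leq\zeta<\omega_1$, $\mathcal{S}_\xi$ consists of $\emptyset$ and all $F\subset\mathbb{N}$ for which there are $n\in\mathbb{N}$ and $F_1<\cdots<F_n$ in $\mathcal{S}_\zeta$ with $\{\min F_k\}_{k=1}^n\in\mathcal{S}_1$ and $F=\bigcup_{k=1}^nF_k$. If $\xi<\omega_1$ is a limit ordinal, fix a strictly increasing sequence $(\zeta_n)$ of non-limit ordinals with $\sup_n\zeta_n=\xi$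 and set $\mathcal{S}_\xi:=\bigcup_{n=1}^\infty\{F\in\mathcal{S}_{\zeta_n}:n\leq F\}$. Finally $\mathcal{S}_{\omega_1}:=\{F\subset\mathbb{N}:\#F<\infty\}$. For $1\leq\xi\leq\omega_1$ put $\mathcal{A}_\xi:=\{(\alpha_k)\in c_{00}:\mathrm{supp}(\alpha_k)\in\mathcal{S}_\xi\}$. For $1\leq p\leq\infty$ and $0\leq C<\infty$, $\mathcal{WD}_{\ell_p}^{(C,\xi)}(X,Y)$ is the set of all $T\in\mathcal{L}(X,Y)$ such that for every $\epsilon>0$, each normalized weakly null sequence $(x_n)\subset X$ admits a subsequence $(x_{n_k})$ with $\|\sum\alpha_kTx_{n_k}\|\leq(C+\epsilon)\|(\alpha_k)\|_{\ell_p}$ for all $(\alpha_k)\in\mathcal{A}_\xi$. Set $\mathcal{WD}_{\ell_p}^{(\infty,\xi)}(X,Y):=\bigcup_{0\leq C<\infty}\mathcal{WD}_{\ell_p}^{(C,\xi)}(X,Y)$. $\overline{\mathcal{WD}}_{\ell_p}^{(\infty,\xi)}$ denotes the class whose component $\overline{\mathcal{WD}}_{\ell_p}^{(\infty,\xi)}(X,Y)$ is the closure of $\mathcal{WD}_{\ell_p}^{(\infty,\xi)}(X,Y)$ in $\mathcal{L}(X,Y)$ in the operator norm. *)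

theory Defs
  imports "HOL-Analysis.Analysis" "HOL-Algebra.Module"
begin

section \<open>Ordinals up to \<open>\<omega>\<^sub>1\<close>\<close>

text \<open>
  The elements of this type are the ordinals below \<open>\<omega>\<^sub>2\<close>; this is large enough to contain
  \<open>\<omega>\<^sub>1\<close> as an element.
\<close>

typedef ordinal = "Field (cardSuc (cardSuc natLeq))"
  using Field_cardSuc_not_empty[OF cardSuc_Card_order[OF natLeq_Card_order]] by blast

instantiation ordinal :: wellorder
begin

definition less_eq_ordinal :: "ordinal \<Rightarrow> ordinal \<Rightarrow> bool" where
  "a \<le> b \<longleftrightarrow> (Rep_ordinal a, Rep_ordinal b) \<in> cardSuc (cardSuc natLeq)"

definition less_ordinal :: "ordinal \<Rightarrow> ordinal \<Rightarrow> bool" where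
  "(a :: ordinal) < b \<longleftrightarrow> a \<le> b \<and> \<not> b \<le> a"

instance
proof -
  let ?r = "cardSuc (cardSuc natLeq)"
  have wo: "Well_order ?r"
    by (simp add: cardSuc_Well_order cardSuc_Card_order natLeq_Card_order)
  then have lin: "refl_on (Field ?r) ?r" "trans ?r" "antisym ?r" "total_on (Field ?r) ?r"
    and wf: "wf (?r - Id)"
    unfolding well_order_on_def linear_order_on_def partial_order_on_def preorder_on_def by auto
  have refl: "x \<le> x" for x :: ordinal
    unfolding less_eq_ordinal_def using lin(1) Rep_ordinal[of x] by (auto simp: refl_on_def)
  have antisym: "x = y" if "x \<le> y" "y \<le> x" for x y :: ordinal
    using antisymD[OF lin(3) that[unfolded less_eq_ordinal_def]] by (rule Rep_ordinal_inject[THEN iffD1])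
  show "OFCLASS(ordinal, wellorder_class)"
  proof
    fix x y z :: ordinal
    show "x < y \<longleftrightarrow> x \<le> y \<and> \<not> y \<le> x" by (rule less_ordinal_def)
    show "x \<le> x" by (rule refl)
    show "x \<le> y \<Longrightarrow> y \<le> z \<Longrightarrow> x \<le> z"
      unfolding less_eq_ordinal_def using lin(2) by (rule transD)
    show "x \<le> y \<Longrightarrow> y \<le> x \<Longrightarrow> x = y" by (rule antisym)
    show "x \<le> y \<or> y \<le> x"
      using lin(4) refl Rep_ordinal[of x] Rep_ordinal[of y]
      unfolding less_eq_ordinal_def total_on_def by metis
  next
    fix P :: "ordinal \<Rightarrow> bool" and a :: ordinal
    assume step: "\<And>x. (\<And>y. y < x \<Longrightarrow> P y) \<Longrightarrow> P x"
    have "wf (inv_image (?r - Id) Rep_ordinal)" using wf by (rule wf_inv_image)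
    moreover have "inv_image (?r - Id) Rep_ordinal = {(x, y). x < y}"
      using antisym refl by (auto simp: inv_image_def less_ordinal_def less_eq_ordinal_def
          Rep_ordinal_inject)
    ultimately have "wf {(x :: ordinal, y). x < y}" by simp
    then show "P a" by (rule wf_induct_rule) (use step in auto)
  qed
qed

end

instance ordinal :: no_top
proof
  fix x :: ordinal
  let ?r = "cardSuc (cardSuc natLeq)"
  have "Card_order ?r" "\<not> finite (Field ?r)"
    using cardSuc_finite[OF natLeq_Card_order]
      cardSuc_finite[OF cardSuc_Card_order[OF natLeq_Card_order]]
    by (simp_all add: cardSuc_Card_order[OF cardSuc_Card_order[OF natLeq_Card_order]] Field_natLeq)
  from infinite_Card_order_limit[OF this Rep_ordinal[of x]]
  obtain b where b: "b \<in> Field ?r" "Rep_ordinal x \<noteq> b" "(Rep_ordinal x, b) \<in> ?r" by blast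
  then have "x \<le> Abs_ordinal b" "x \<noteq> Abs_ordinal b"
    by (auto simp: less_eq_ordinal_def Abs_ordinal_inverse)
  then have "x < Abs_ordinal b" by (rule le_neq_trans)
  then show "\<exists>y. x < y" by blast
qed

definition ord_suc :: "ordinal \<Rightarrow> ordinal" where
  "ord_suc \<xi> = (LEAST \<eta>. \<xi> < \<eta>)"

instantiation ordinal :: "{zero, one}"
begin

definition zero_ordinal :: ordinal where "0 = (LEAST \<xi> :: ordinal. True)"

definition one_ordinal :: ordinal where "1 = ord_suc 0"

instance ..

end

definition omega1 :: ordinal where
  "omega1 = (LEAST \<xi>. uncountable {..<\<xi>})"

definition is_limit :: "ordinal \<Rightarrow> bool" where
  "is_limit \<xi> \<longleftrightarrow> \<xi> \<noteq> 0 \<and> (\<forall>\<zeta>. \<xi> \<noteq> ord_suc \<zeta>)"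

lemma ord_suc_greater: "\<xi> < ord_suc \<xi>"
  unfolding ord_suc_def using gt_ex by (rule LeastI_ex)

lemma ord_suc_le_iff: "ord_suc \<xi> \<le> \<eta> \<longleftrightarrow> \<xi> < \<eta>"
  using ord_suc_greater[of \<xi>] by (auto simp: ord_suc_def intro: Least_le)

lemma zero_le_ordinal: "(0 :: ordinal) \<le> \<xi>"
  unfolding zero_ordinal_def by (rule Least_le) simp

lemma ex_uncountable_ordinal:
  includes cardinal_syntax
  shows "\<exists>\<xi> :: ordinal. uncountable {..<\<xi>}"
proof -
  let ?s = "cardSuc natLeq" let ?r = "cardSuc ?s"
  have cs: "Card_order ?s" "Card_order ?r"
    by (simp_all add: cardSuc_Card_order natLeq_Card_order)
  have wo: "Well_order ?s" "Well_order ?r"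
    using cs by (auto simp: card_order_on_def)
  have "?s <o ?r" using cs(1) by (rule cardSuc_greater)
  then obtain a where a: "a \<in> Field ?r" "?s =o Restr ?r (underS ?r a)"
    using ordLess_iff_ordIso_Restr[OF wo(2) wo(1)] by blast
  have "|Field ?s| =o |Field (Restr ?r (underS ?r a))|"
    using a(2) by (rule card_of_cong)
  moreover have "Field (Restr ?r (underS ?r a)) \<subseteq> underS ?r a" by (auto simp: Field_def)
  ultimately have le: "|Field ?s| \<le>o |underS ?r a|"
    using card_of_mono1 ordIso_ordLeq_trans by blast
  have sub: "underS ?r a \<subseteq> Rep_ordinal ` {..<Abs_ordinal a}"
  proof
    fix b assume b: "b \<in> underS ?r a"
    then have bF: "b \<in> Field ?r" by (auto simp: underS_def Field_def)
    have "Abs_ordinal b \<le> Abs_ordinal a" "Abs_ordinal b \<noteq> Abs_ordinal a"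
      using b bF a(1)
      by (auto simp: underS_def less_eq_ordinal_def Abs_ordinal_inverse Abs_ordinal_inject)
    then have "Abs_ordinal b \<in> {..<Abs_ordinal a}" by auto
    then show "b \<in> Rep_ordinal ` {..<Abs_ordinal a}"
      using bF Abs_ordinal_inverse[OF bF] by (metis imageI)
  qed
  have "uncountable {..<Abs_ordinal a}"
  proof
    assume "countable {..<Abs_ordinal a}"
    then have "countable (underS ?r a)" using sub by (metis countable_image countable_subset)
    then obtain f :: "_ \<Rightarrow> nat" where "inj_on f (underS ?r a)" by (auto simp: countable_def)
    then have "|underS ?r a| \<le>o |UNIV :: nat set|"
      using card_of_ordLeq[of "underS ?r a" "UNIV :: nat set"] by auto
    then have "|Field ?s| \<le>o |UNIV :: nat set|" using le ordLeq_transitive by blast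
    then have "?s \<le>o natLeq"
      using card_of_nat card_of_Field_ordIso[OF cs(1)] ordIso_symmetric
        ordIso_ordLeq_trans ordLeq_ordIso_trans by blast
    then show False
      using cardSuc_greater[OF natLeq_Card_order] not_ordLess_ordLeq by blast
  qed
  then show ?thesis by blast
qed

lemma less_omega1_iff: "\<xi> < omega1 \<longleftrightarrow> countable {..<\<xi>}"
proof
  show "\<xi> < omega1 \<Longrightarrow> countable {..<\<xi>}"
    unfolding omega1_def using not_less_Least by blast
next
  assume c: "countable {..<\<xi>}"
  have "uncountable {..<omega1}"
    unfolding omega1_def using ex_uncountable_ordinal by (rule LeastI_ex)
  then have "\<not> {..<omega1} \<subseteq> {..<\<xi>}" using c countable_subset by blast
  then show "\<xi> < omega1" by (meson lessThan_subset_iff not_le)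
qed


section \<open>Schreier families\<close>

text \<open>
  Throughout, \<open>\<nat> = {1, 2, \<dots>}\<close>: sequences are functions on \<^typ>\<open>nat\<close> whose value at \<open>0\<close> is
  ignored (or is \<open>0\<close>, for coefficient sequences).

  \<open>limit_sequences Z\<close> says that \<open>Z\<close> is one of the possible choices, for each limit ordinal
  \<open>\<xi> < \<omega>\<^sub>1\<close>, of the sequence \<open>(\<zeta>\<^sub>n)\<close> used to define the Schreier family at \<open>\<xi>\<close>.
\<close>

definition limit_sequences :: "(ordinal \<Rightarrow> nat \<Rightarrow> ordinal) \<Rightarrow> bool" where
  "limit_sequences Z \<longleftrightarrow>
     (\<forall>\<xi>. is_limit \<xi> \<and> \<xi> < omega1 \<longrightarrow>
        strict_mono_on {1..} (Z \<xi>) \<and>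
        (\<forall>n\<ge>1. \<not> is_limit (Z \<xi> n)) \<and>
        (\<forall>n\<ge>1. Z \<xi> n \<le> \<xi>) \<and> (\<forall>\<eta>. (\<forall>n\<ge>1. Z \<xi> n \<le> \<eta>) \<longrightarrow> \<xi> \<le> \<eta>))"

lemma limit_sequences_exist: "\<exists>Z. limit_sequences Z"
proof -
  have "\<exists>z :: nat \<Rightarrow> ordinal. strict_mono_on {1..} z \<and> (\<forall>n\<ge>1. \<not> is_limit (z n)) \<and>
      (\<forall>n\<ge>1. z n \<le> \<xi>) \<and> (\<forall>\<eta>. (\<forall>n\<ge>1. z n \<le> \<eta>) \<longrightarrow> \<xi> \<le> \<eta>)"
    if lim: "is_limit \<xi>" and c: "\<xi> < omega1" for \<xi>
  proof -
    have suc: "ord_suc \<eta> < \<xi>" if "\<eta> < \<xi>" for \<eta>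
      using that lim ord_suc_le_iff[of \<eta> \<xi>] by (auto simp: is_limit_def le_less)
    have "0 < \<xi>" using lim zero_le_ordinal[of \<xi>] by (auto simp: is_limit_def le_less)
    then have ne: "{..<\<xi>} \<noteq> {}" by auto
    define e where "e = from_nat_into {..<\<xi>}"
    have e: "range e = {..<\<xi>}"
      unfolding e_def using c ne by (simp add: less_omega1_iff range_from_nat_into)
    define z where "z = rec_nat (ord_suc (e 0)) (\<lambda>n y. ord_suc (max y (e (Suc n))))"
    have zS: "z (Suc n) = ord_suc (max (z n) (e (Suc n)))" for n by (simp add: z_def)
    have z_lt: "z n < \<xi>" for n
      by (induction n) (use e in \<open>auto simp: z_def intro!: suc\<close>)
    have z_lim: "\<not> is_limit (z n)" for n by (cases n) (auto simp: z_def is_limit_def)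
    have e_lt: "e n < z n" for n
      by (cases n) (auto simp: z_def intro: ord_suc_greater le_less_trans[OF max.cobounded2])
    have mono: "strict_mono z"
      by (rule strict_monoI_Suc) (auto simp: zS intro: le_less_trans[OF max.cobounded1 ord_suc_greater])
    have lub: "\<xi> \<le> \<eta>" if le: "\<forall>n\<ge>1. z n \<le> \<eta>" for \<eta>
    proof (rule ccontr)
      assume "\<not> \<xi> \<le> \<eta>"
      then obtain n where n: "\<eta> = e n" using e by (metis lessThan_iff not_le imageE)
      have "z n \<le> z (Suc n)" using mono by (simp add: strict_mono_less_eq)
      then have "e n < \<eta>" using e_lt[of n] le[rule_format, of "Suc n"] by auto
      then show False using n by simp
    qed
    show ?thesis
    proof (intro exI[of _ z] conjI)
      show "strict_mono_on {1..} z"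
        using mono by (auto simp: strict_mono_on_def strict_mono_def)
      show "\<forall>n\<ge>1. \<not> is_limit (z n)" using z_lim by simp
      show "\<forall>n\<ge>1. z n \<le> \<xi>" using z_lt by (simp add: less_imp_le)
      show "\<forall>\<eta>. (\<forall>n\<ge>1. z n \<le> \<eta>) \<longrightarrow> \<xi> \<le> \<eta>" using lub by simp
    qed
  qed
  then have "\<forall>\<xi>. \<exists>z :: nat \<Rightarrow> ordinal. is_limit \<xi> \<and> \<xi> < omega1 \<longrightarrow> strict_mono_on {1..} z \<and>
      (\<forall>n\<ge>1. \<not> is_limit (z n)) \<and> (\<forall>n\<ge>1. z n \<le> \<xi>) \<and>
      (\<forall>\<eta>. (\<forall>n\<ge>1. z n \<le> \<eta>) \<longrightarrow> \<xi> \<le> \<eta>)" by blast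
  then show ?thesis unfolding limit_sequences_def by (rule choice)
qed

definition schreier_one :: "nat set set" where
  "schreier_one = {F. F \<subseteq> {1..} \<and> F \<noteq> {} \<and> finite F \<and> card F \<le> Min F} \<union> {{}}"

text \<open>
  The recursion on the ordinal, written as an inductive definition: every \<open>\<xi> \<le> \<omega>\<^sub>1\<close> falls
  under exactly one of the cases \<open>0\<close>, \<open>1\<close>, \<open>\<zeta> + 1\<close> with \<open>\<zeta> \<ge> 1\<close>, limit below \<open>\<omega>\<^sub>1\<close>,
  and \<open>\<omega>\<^sub>1\<close>.
\<close>

inductive_set schreier_rel :: "(ordinal \<Rightarrow> nat \<Rightarrow> ordinal) \<Rightarrow> (ordinal \<times> nat set) set"
  for Z :: "ordinal \<Rightarrow> nat \<Rightarrow> ordinal" where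
  zero: "F \<in> {{n} | n. n \<ge> 1} \<union> {{}} \<Longrightarrow> (0, F) \<in> schreier_rel Z"
| one: "F \<in> schreier_one \<Longrightarrow> (1, F) \<in> schreier_rel Z"
| suc_empty: "1 \<le> \<zeta> \<Longrightarrow> \<zeta> < omega1 \<Longrightarrow> (ord_suc \<zeta>, {}) \<in> schreier_rel Z"
| suc: "1 \<le> \<zeta> \<Longrightarrow> \<zeta> < omega1 \<Longrightarrow> Fs \<noteq> [] \<Longrightarrow>
    \<forall>F\<in>set Fs. F \<noteq> {} \<and> (\<zeta>, F) \<in> schreier_rel Z \<Longrightarrow>
    sorted_wrt (\<lambda>E F. Max E < Min F) Fs \<Longrightarrow>
    Min ` set Fs \<in> schreier_one \<Longrightarrow>
    (ord_suc \<zeta>, \<Union> (set Fs)) \<in> schreier_rel Z"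
| limit: "is_limit \<xi> \<Longrightarrow> \<xi> < omega1 \<Longrightarrow> n \<ge> 1 \<Longrightarrow>
    (Z \<xi> n, F) \<in> schreier_rel Z \<Longrightarrow> \<forall>m\<in>F. n \<le> m \<Longrightarrow> (\<xi>, F) \<in> schreier_rel Z"
| omega1: "F \<subseteq> {1..} \<Longrightarrow> finite F \<Longrightarrow> (omega1, F) \<in> schreier_rel Z"

definition schreier :: "(ordinal \<Rightarrow> nat \<Rightarrow> ordinal) \<Rightarrow> ordinal \<Rightarrow> nat set set" where
  "schreier Z \<xi> = {F. (\<xi>, F) \<in> schreier_rel Z}"


section \<open>Banach spaces over the scalar field \<open>'k\<close>\<close>

text \<open>
  The scalars are an arbitrary complete \<^class>\<open>real_normed_field\<close>. By the Gelfand--Mazur theorem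
  these are exactly \<open>\<real>\<close> and \<open>\<complex>\<close>, up to isometric isomorphism. Since HOL
  cannot quantify existentially over types, the spaces are records with an explicit carrier, of
  points of some type \<open>'a\<close>. For \<open>'a = nat \<Rightarrow> 'k\<close> these represent all Banach spaces of at most
  continuum cardinality; the linear structure need not be the pointwise one. The ring operations
  \<^const>\<open>mult\<close> and \<^const>\<open>one\<close> inherited from \<^typ>\<open>('k, 'a) module\<close> are not used.
\<close>

record ('k, 'a) normed_module = "('k, 'a) module" +
  vnorm :: "'a \<Rightarrow> real"

definition scalars :: "('k :: {real_normed_field, banach}, 'k) normed_module" where
  "scalars = \<lparr>carrier = UNIV, mult = (*), one = 1, zero = 0, add = (+), smult = (*), vnorm = norm\<rparr>"

text \<open>The value off the carrier only serves to satisfy \<^locale>\<open>Metric_space\<close>.\<close>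

definition vdist :: "('k, 'a) normed_module \<Rightarrow> 'a \<Rightarrow> 'a \<Rightarrow> real" where
  "vdist X x y = (if x \<in> carrier X \<and> y \<in> carrier X then vnorm X (x \<ominus>\<^bsub>X\<^esub> y) else 0)"

abbreviation norm_topology :: "('k, 'a) normed_module \<Rightarrow> 'a topology" where
  "norm_topology X \<equiv> Metric_space.mtopology (carrier X) (vdist X)"

locale normed_space =
  module scalars X
  for X :: "('k :: {real_normed_field, banach}, 'a) normed_module" (structure) +
  assumes vnorm_nonneg: "x \<in> carrier X \<Longrightarrow> 0 \<le> vnorm X x"
    and vnorm_eq_zero: "x \<in> carrier X \<Longrightarrow> vnorm X x = 0 \<Longrightarrow> x = \<zero>\<^bsub>X\<^esub>"
    and vnorm_smult: "x \<in> carrier X \<Longrightarrow> vnorm X (a \<odot>\<^bsub>X\<^esub> x) = norm a * vnorm X x"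
    and vnorm_triangle: "x \<in> carrier X \<Longrightarrow> y \<in> carrier X \<Longrightarrow>
      vnorm X (x \<oplus>\<^bsub>X\<^esub> y) \<le> vnorm X x + vnorm X y"

context normed_space
begin

lemma vnorm_zero [simp]: "vnorm X \<zero> = 0"
proof -
  have "0 \<odot> \<zero> = \<zero>"
    using smult_l_null[of "\<zero>"] by (simp add: scalars_def)
  then show ?thesis using vnorm_smult[of "\<zero>" 0] by simp
qed

lemma vnorm_minus_commute:
  assumes "x \<in> carrier X" "y \<in> carrier X"
  shows "vnorm X (x \<ominus> y) = vnorm X (y \<ominus> x)"
proof -
  have "\<ominus>\<^bsub>scalars\<^esub> (1 :: 'k) = -1"
    by (rule R.minus_equality) (simp_all add: scalars_def)
  then have "(-1) \<odot> (y \<ominus> x) = \<ominus> (y \<ominus> x)"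
    using smult_l_minus[of 1 "y \<ominus> x"] smult_one[of "y \<ominus> x"] assms
    by (simp add: scalars_def)
  also have "\<dots> = x \<ominus> y"
    using assms by (simp add: a_minus_def minus_add M.minus_minus M.a_comm)
  finally show ?thesis
    using vnorm_smult[of "y \<ominus> x" "-1"] assms by simp
qed

lemma minus_zero_right: "x \<in> carrier X \<Longrightarrow> x \<ominus> \<zero> = x"
  using M.minus_equality[of "\<zero>" "\<zero>"] by (simp add: a_minus_def)

lemma minus_eq_zero_iff:
  assumes "x \<in> carrier X" "y \<in> carrier X"
  shows "x \<ominus> y = \<zero> \<longleftrightarrow> x = y"
  using assms by (metis M.minus_equality M.minus_minus M.r_neg a_minus_def M.a_inv_closed)

lemma minus_triangle:
  assumes "x \<in> carrier X" "y \<in> carrier X" "z \<in> carrier X"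
  shows "vnorm X (x \<ominus> z) \<le> vnorm X (x \<ominus> y) + vnorm X (y \<ominus> z)"
proof -
  have "x \<ominus> z = (x \<ominus> y) \<oplus> (y \<ominus> z)"
    using assms by (simp add: a_minus_def M.a_assoc M.r_neg1)
  then show ?thesis using vnorm_triangle[of "x \<ominus> y" "y \<ominus> z"] assms by simp
qed

lemma Metric_space_vdist: "Metric_space (carrier X) (vdist X)"
proof
  show "0 \<le> vdist X x y" "vdist X x y = vdist X y x" for x y
    by (auto simp: vdist_def vnorm_nonneg vnorm_minus_commute)
  show "vdist X x y = 0 \<longleftrightarrow> x = y" if "x \<in> carrier X" "y \<in> carrier X" for x y
    using that vnorm_eq_zero[of "x \<ominus> y"] minus_eq_zero_iff[of x y] by (auto simp: vdist_def)
  show "vdist X x z \<le> vdist X x y + vdist X y z"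
    if "x \<in> carrier X" "y \<in> carrier X" "z \<in> carrier X" for x y z
    using that by (simp add: vdist_def minus_triangle)
qed

end

locale banach_space = normed_space +
  assumes complete: "Metric_space.mcomplete (carrier X) (vdist X)"

text \<open>
  \<open>\<L>(X, Y)\<close>; operators are \<^const>\<open>undefined\<close> outside the carrier of \<open>X\<close>, so that
  equality of functions is equality of operators.
\<close>

definition operators ::
    "('k :: {real_normed_field, banach}, 'a) normed_module \<Rightarrow> ('k, 'b) normed_module \<Rightarrow> ('a \<Rightarrow> 'b) set"
  where
  "operators X Y = {T \<in> carrier X \<rightarrow>\<^sub>E carrier Y.
     (\<forall>x\<in>carrier X. \<forall>y\<in>carrier X. T (x \<oplus>\<^bsub>X\<^esub> y) = T x \<oplus>\<^bsub>Y\<^esub> T y) \<and>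
     (\<forall>a. \<forall>x\<in>carrier X. T (a \<odot>\<^bsub>X\<^esub> x) = a \<odot>\<^bsub>Y\<^esub> T x) \<and>
     continuous_map (norm_topology X) (norm_topology Y) T}"

definition opnorm ::
    "('k, 'a) normed_module \<Rightarrow> ('k, 'b) normed_module \<Rightarrow> ('a \<Rightarrow> 'b) \<Rightarrow> real" where
  "opnorm X Y T = (SUP x \<in> {x \<in> carrier X. vnorm X x \<le> 1}. vnorm Y (T x))"

definition opdist ::
    "('k :: {real_normed_field, banach}, 'a) normed_module \<Rightarrow> ('k, 'b) normed_module \<Rightarrow>
      ('a \<Rightarrow> 'b) \<Rightarrow> ('a \<Rightarrow> 'b) \<Rightarrow> real" where
  "opdist X Y S T =
     (if S \<in> operators X Y \<and> T \<in> operators X Y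
      then opnorm X Y (\<lambda>x\<in>carrier X. S x \<ominus>\<^bsub>Y\<^esub> T x) else 0)"

lemma operators_zero:
  assumes "normed_space X" "normed_space Y" "T \<in> operators X Y"
  shows "T \<zero>\<^bsub>X\<^esub> = \<zero>\<^bsub>Y\<^esub>"
proof -
  interpret X: normed_space X by fact
  interpret Y: normed_space Y by fact
  have "T (0 \<odot>\<^bsub>X\<^esub> \<zero>\<^bsub>X\<^esub>) = 0 \<odot>\<^bsub>Y\<^esub> T \<zero>\<^bsub>X\<^esub>" "T \<zero>\<^bsub>X\<^esub> \<in> carrier Y"
    using assms(3) by (auto simp: operators_def)
  then show ?thesis
    using X.smult_l_null[of "\<zero>\<^bsub>X\<^esub>"] Y.smult_l_null[of "T \<zero>\<^bsub>X\<^esub>"] by (simp add: scalars_def)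
qed

lemma operators_bounded:
  fixes X :: "('k :: {real_normed_field, banach}, 'a) normed_module"
  assumes X: "normed_space X" and Y: "normed_space Y" and T: "T \<in> operators X Y"
  obtains K where "\<And>x. x \<in> carrier X \<Longrightarrow> vnorm X x \<le> 1 \<Longrightarrow> vnorm Y (T x) \<le> K"
proof -
  interpret X: normed_space X by fact
  interpret Y: normed_space Y by fact
  interpret MX: Metric_space "carrier X" "vdist X" by (rule X.Metric_space_vdist)
  interpret MY: Metric_space "carrier Y" "vdist Y" by (rule Y.Metric_space_vdist)
  have cont: "continuous_map (norm_topology X) (norm_topology Y) T"
    and TY: "\<And>x. x \<in> carrier X \<Longrightarrow> T x \<in> carrier Y"
    and hom: "\<And>a x. x \<in> carrier X \<Longrightarrow> T (a \<odot>\<^bsub>X\<^esub> x) = a \<odot>\<^bsub>Y\<^esub> T x"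
    using T by (auto simp: operators_def)
  have T0: "T \<zero>\<^bsub>X\<^esub> = \<zero>\<^bsub>Y\<^esub>" using X Y T by (rule operators_zero)
  have dX: "vdist X \<zero>\<^bsub>X\<^esub> x = vnorm X x" if "x \<in> carrier X" for x
    using that X.vnorm_minus_commute[of "\<zero>\<^bsub>X\<^esub>" x] by (simp add: vdist_def X.minus_zero_right)
  have dY: "vdist Y \<zero>\<^bsub>Y\<^esub> y = vnorm Y y" if "y \<in> carrier Y" for y
    using that Y.vnorm_minus_commute[of "\<zero>\<^bsub>Y\<^esub>" y] by (simp add: vdist_def Y.minus_zero_right)
  obtain \<delta> where \<delta>: "\<delta> > 0"
    "\<And>x. x \<in> carrier X \<Longrightarrow> vnorm X x < \<delta> \<Longrightarrow> vnorm Y (T x) < 1"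
  proof -
    have "\<exists>\<delta>>0. \<forall>x. x \<in> carrier X \<and> vdist X \<zero>\<^bsub>X\<^esub> x < \<delta> \<longrightarrow> vdist Y (T \<zero>\<^bsub>X\<^esub>) (T x) < 1"
      using cont X.zero_closed zero_less_one
      unfolding MX.metric_continuous_map[OF MY.Metric_space_axioms]
      by blast
    then show ?thesis using that T0 dX dY TY by metis
  qed
  have "vnorm Y (T x) \<le> 2 / \<delta>" if x: "x \<in> carrier X" "vnorm X x \<le> 1" for x
  proof -
    define a :: 'k where "a = of_real (\<delta> / 2)"
    have a: "norm a = \<delta> / 2" using \<delta>(1) by (simp add: a_def)
    have cl: "a \<odot>\<^bsub>X\<^esub> x \<in> carrier X" using x X.smult_closed[of a x] by (simp add: scalars_def)
    have "vnorm X (a \<odot>\<^bsub>X\<^esub> x) \<le> \<delta> / 2 * 1"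
      unfolding X.vnorm_smult[OF x(1)] a using x(2) \<delta>(1) by (intro mult_left_mono) auto
    then have "vnorm Y (T (a \<odot>\<^bsub>X\<^esub> x)) < 1" using \<delta> cl by auto
    then have "\<delta> / 2 * vnorm Y (T x) < 1"
      using hom[OF x(1)] Y.vnorm_smult[OF TY[OF x(1)]] a by simp
    then show ?thesis using \<delta>(1) by (simp add: field_simps)
  qed
  then show ?thesis by (rule that)
qed

lemma Metric_space_opdist:
  fixes X :: "('k :: {real_normed_field, banach}, 'a) normed_module"
  assumes X: "normed_space X" and Y: "normed_space Y"
  shows "Metric_space (operators X Y) (opdist X Y)"
proof -
  interpret X: normed_space X by fact
  interpret Y: normed_space Y by fact
  let ?B = "{x \<in> carrier X. vnorm X x \<le> 1}"
  let ?n = "\<lambda>S T x. vnorm Y (S x \<ominus>\<^bsub>Y\<^esub> T x)"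
  have dist: "opdist X Y S T = (SUP x\<in>?B. ?n S T x)"
    if "S \<in> operators X Y" "T \<in> operators X Y" for S T
    using that by (auto simp: opdist_def opnorm_def intro!: SUP_cong)
  have cl: "T x \<in> carrier Y" if "T \<in> operators X Y" "x \<in> carrier X" for T x
    using that by (auto simp: operators_def)
  have zB: "\<zero>\<^bsub>X\<^esub> \<in> ?B" by simp
  have bdd: "bdd_above (?n S T ` ?B)" if S: "S \<in> operators X Y" and T: "T \<in> operators X Y" for S T
  proof -
    obtain K where K: "\<And>x. x \<in> carrier X \<Longrightarrow> vnorm X x \<le> 1 \<Longrightarrow> vnorm Y (S x) \<le> K"
      using operators_bounded[OF X Y S] by blast
    obtain L where L: "\<And>x. x \<in> carrier X \<Longrightarrow> vnorm X x \<le> 1 \<Longrightarrow> vnorm Y (T x) \<le> L"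
      using operators_bounded[OF X Y T] by blast
    have "?n S T x \<le> K + L" if x: "x \<in> carrier X" "vnorm X x \<le> 1" for x
    proof -
      have "?n S T x \<le> vnorm Y (S x \<ominus>\<^bsub>Y\<^esub> \<zero>\<^bsub>Y\<^esub>) + vnorm Y (T x \<ominus>\<^bsub>Y\<^esub> \<zero>\<^bsub>Y\<^esub>)"
        using Y.minus_triangle[of "S x" "\<zero>\<^bsub>Y\<^esub>" "T x"] Y.vnorm_minus_commute[of "\<zero>\<^bsub>Y\<^esub>" "T x"]
          cl[OF S x(1)] cl[OF T x(1)] by simp
      also have "\<dots> = vnorm Y (S x) + vnorm Y (T x)"
        using cl[OF S x(1)] cl[OF T x(1)] by (simp add: Y.minus_zero_right)
      finally show ?thesis using K[OF x] L[OF x] by simp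
    qed
    then show ?thesis by (auto simp: bdd_above_def)
  qed
  have upper: "?n S T x \<le> opdist X Y S T"
    if "S \<in> operators X Y" "T \<in> operators X Y" "x \<in> ?B" for S T x
    unfolding dist[OF that(1,2)] using that(3) bdd[OF that(1,2)] by (rule cSUP_upper)
  show ?thesis
  proof
    show "0 \<le> opdist X Y S T" for S T
    proof (cases "S \<in> operators X Y \<and> T \<in> operators X Y")
      case True
      then have "0 \<le> ?n S T \<zero>\<^bsub>X\<^esub>" using cl[of _ "\<zero>\<^bsub>X\<^esub>"] by (intro Y.vnorm_nonneg) auto
      then show ?thesis using upper[OF _ _ zB, of S T] True by linarith
    qed (auto simp: opdist_def)
    show "opdist X Y S T = opdist X Y T S" for S T
    proof (cases "S \<in> operators X Y \<and> T \<in> operators X Y")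
      case True
      then show ?thesis
        by (simp add: dist) (intro SUP_cong refl, auto intro!: Y.vnorm_minus_commute cl)
    qed (auto simp: opdist_def)
    show "opdist X Y S T = 0 \<longleftrightarrow> S = T"
      if S: "S \<in> operators X Y" and T: "T \<in> operators X Y" for S T
    proof
      assume "S = T"
      then have "?n S T x = 0" if "x \<in> ?B" for x
        using that Y.minus_eq_zero_iff[of "T x" "T x"] cl[OF T, of x] by simp
      then have "(SUP x\<in>?B. ?n S T x) = (SUP x\<in>?B. 0)" by (intro SUP_cong) auto
      also have "\<dots> = 0" using zB by (intro cSUP_const) blast
      finally show "opdist X Y S T = 0" using dist[OF S T] by simp
    next
      assume 0: "opdist X Y S T = 0"
      have ball: "S x = T x" if "x \<in> ?B" for x
      proof -
        have c: "S x \<in> carrier Y" "T x \<in> carrier Y" using that cl S T by auto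
        then have "?n S T x = 0"
          using upper[OF S T that] 0 Y.vnorm_nonneg[of "S x \<ominus>\<^bsub>Y\<^esub> T x"] by simp
        then show ?thesis
          using Y.vnorm_eq_zero[of "S x \<ominus>\<^bsub>Y\<^esub> T x"] Y.minus_eq_zero_iff[OF c] c by simp
      qed
      have "S x = T x" if x: "x \<in> carrier X" for x
      proof (cases "vnorm X x \<le> 1")
        case True then show ?thesis using ball x by simp
      next
        case False
        define c where "c = vnorm X x"
        have c: "c > 0" using False by (simp add: c_def)
        define a b :: 'k where "a = of_real (1 / c)" and "b = of_real c"
        have ba: "b * a = 1" and na: "norm a = 1 / c" using c by (auto simp: a_def b_def norm_divide)
        have ax: "a \<odot>\<^bsub>X\<^esub> x \<in> carrier X" using x X.smult_closed[of a x] by (simp add: scalars_def)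
        have "vnorm X (a \<odot>\<^bsub>X\<^esub> x) = 1" using X.vnorm_smult[OF x, of a] na c by (simp add: c_def)
        then have "S (a \<odot>\<^bsub>X\<^esub> x) = T (a \<odot>\<^bsub>X\<^esub> x)" using ball ax by simp
        moreover have "b \<odot>\<^bsub>X\<^esub> (a \<odot>\<^bsub>X\<^esub> x) = x"
          using X.smult_assoc1[of b a x] X.smult_one[OF x] x ba by (simp add: scalars_def)
        moreover have "S (b \<odot>\<^bsub>X\<^esub> (a \<odot>\<^bsub>X\<^esub> x)) = b \<odot>\<^bsub>Y\<^esub> S (a \<odot>\<^bsub>X\<^esub> x)"
          "T (b \<odot>\<^bsub>X\<^esub> (a \<odot>\<^bsub>X\<^esub> x)) = b \<odot>\<^bsub>Y\<^esub> T (a \<odot>\<^bsub>X\<^esub> x)"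
          using S T ax by (auto simp: operators_def)
        ultimately show ?thesis by metis
      qed
      then show "S = T"
        using S T by (intro PiE_ext[of S "carrier X" "\<lambda>_. carrier Y" T]) (auto simp: operators_def)
    qed
    show "opdist X Y R T \<le> opdist X Y R S + opdist X Y S T"
      if R: "R \<in> operators X Y" and S: "S \<in> operators X Y" and T: "T \<in> operators X Y" for R S T
    proof -
      have "?n R T x \<le> opdist X Y R S + opdist X Y S T" if x: "x \<in> ?B" for x
      proof -
        have "?n R T x \<le> ?n R S x + ?n S T x"
          using x R S T by (intro Y.minus_triangle cl) auto
        then show ?thesis using upper[OF R S x] upper[OF S T x] by linarith
      qed
      then show ?thesis unfolding dist[OF R T] using zB by (intro cSUP_least) auto
    qed
  qed
qed

definition norm_closure ::
    "('k :: {real_normed_field, banach}, 'a) normed_module \<Rightarrow> ('k, 'b) normed_module \<Rightarrow>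
      ('a \<Rightarrow> 'b) set \<Rightarrow> ('a \<Rightarrow> 'b) set" where
  "norm_closure X Y \<T> = Metric_space.mtopology (operators X Y) (opdist X Y) closure_of \<T>"

definition weakly_null ::
    "('k :: {real_normed_field, banach}, 'a) normed_module \<Rightarrow> (nat \<Rightarrow> 'a) \<Rightarrow> bool" where
  "weakly_null X x \<longleftrightarrow> (\<forall>f\<in>operators X scalars. (\<lambda>n. f (x n)) \<longlonglongrightarrow> 0)"


section \<open>The classes \<open>\<W>\<D>\<close>\<close>

definition supp :: "(nat \<Rightarrow> 'k :: zero) \<Rightarrow> nat set" where
  "supp \<alpha> = {k. \<alpha> k \<noteq> 0}"

definition schreier_coeffs ::
    "(ordinal \<Rightarrow> nat \<Rightarrow> ordinal) \<Rightarrow> ordinal \<Rightarrow> (nat \<Rightarrow> 'k :: zero) set" where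
  "schreier_coeffs Z \<xi> = {\<alpha>. finite (supp \<alpha>) \<and> supp \<alpha> \<in> schreier Z \<xi>}"

text \<open>The \<open>\<ell>\<^sub>p\<close>-norm of a finitely supported sequence.\<close>

definition lp_norm :: "ereal \<Rightarrow> (nat \<Rightarrow> 'k :: real_normed_field) \<Rightarrow> real" where
  "lp_norm p \<alpha> =
     (if p = \<infinity> then SUP k. norm (\<alpha> k)
      else (\<Sum>k\<in>supp \<alpha>. norm (\<alpha> k) powr real_of_ereal p) powr (1 / real_of_ereal p))"

definition WD ::
    "(ordinal \<Rightarrow> nat \<Rightarrow> ordinal) \<Rightarrow> ereal \<Rightarrow> real \<Rightarrow> ordinal \<Rightarrow>
      ('k :: {real_normed_field, banach}, 'a) normed_module \<Rightarrow> ('k, 'b) normed_module \<Rightarrow>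
      ('a \<Rightarrow> 'b) set" where
  "WD Z p C \<xi> X Y = {T \<in> operators X Y.
     \<forall>\<epsilon>>0. \<forall>x. (\<forall>n\<ge>1. x n \<in> carrier X \<and> vnorm X (x n) = 1) \<and> weakly_null X x \<longrightarrow>
       (\<exists>r. strict_mono r \<and>
          (\<forall>\<alpha>\<in>schreier_coeffs Z \<xi>.
             vnorm Y (\<Oplus>\<^bsub>Y\<^esub>k\<in>supp \<alpha>. \<alpha> k \<odot>\<^bsub>Y\<^esub> T (x (r k))) \<le> (C + \<epsilon>) * lp_norm p \<alpha>))}"

definition WD_inf ::
    "(ordinal \<Rightarrow> nat \<Rightarrow> ordinal) \<Rightarrow> ereal \<Rightarrow> ordinal \<Rightarrow>
      ('k :: {real_normed_field, banach}, 'a) normed_module \<Rightarrow> ('k, 'b) normed_module \<Rightarrow>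
      ('a \<Rightarrow> 'b) set" where
  "WD_inf Z p \<xi> X Y = (\<Union>C\<in>{0..}. WD Z p C \<xi> X Y)"

definition WD_closure ::
    "(ordinal \<Rightarrow> nat \<Rightarrow> ordinal) \<Rightarrow> ereal \<Rightarrow> ordinal \<Rightarrow>
      ('k :: {real_normed_field, banach}, 'a) normed_module \<Rightarrow> ('k, 'b) normed_module \<Rightarrow>
      ('a \<Rightarrow> 'b) set" where
  "WD_closure Z p \<xi> X Y = norm_closure X Y (WD_inf Z p \<xi> X Y)"

end

theory Submission
  imports Defs
begin

text \<open>
  For \<open>q < p\<close> an upper \<open>\<ell>\<^sub>p\<close>-estimate is stronger than an upper \<open>\<ell>\<^sub>q\<close>-estimate, so an operator is
  wanted that admits \<open>\<ell>\<^sub>q\<close>-estimates and is not a norm limit of operators that admit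
  \<open>\<ell>\<^sub>p\<close>-estimates. The identity of \<open>\<ell>\<^sub>s\<close> has this property for every \<open>s\<close> with \<open>q < s < p\<close>. The choice of
  an intermediate exponent, rather than \<open>q\<close> itself, handles the end points: \<open>\<ell>\<^sub>1\<close> would fail for
  \<open>q = 1\<close>, because it has no normalized weakly null sequences, so that its identity lies in all the
  classes.

  The identity is of class \<open>\<W>\<D>\<close> for \<open>q\<close> (\<open>identity_in_WD\<close>): a normalized weakly null sequence of
  \<open>\<ell>\<^sub>s\<close> has a subsequence that is a small perturbation of a disjointly supported one
  (\<open>coordinatewise_null_upper_estimate\<close>), and disjointly supported vectors satisfy an upper
  \<open>\<ell>\<^sub>s\<close>-estimate, hence an upper \<open>\<ell>\<^sub>q\<close>-estimate.

  It is not in the closure of the class for \<open>p\<close> (\<open>identity_notin_WD_closure\<close>). The unit vectors are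
  weakly null because \<open>s > 1\<close> (\<open>unit_vec_weakly_null\<close>). A sum of \<open>m\<close> of them has norm \<open>m\<^bsup>1/s\<^esup>\<close>, and an
  operator close to the identity shrinks it at most by half, whereas an \<open>\<ell>\<^sub>p\<close>-estimate allows
  only a multiple of \<open>m\<^bsup>1/p\<^esup>\<close>. The estimate may be applied to such sums for every \<open>\<xi>\<close>, since each Schreier
  family of index at least \<open>1\<close> contains \<open>{m..<2 * m}\<close> for \<open>m \<ge> 2\<close> (\<open>interval_in_schreier\<close>).
\<close>

section \<open>The Banach spaces \<open>\<ell>\<^sub>s\<close>\<close>

definition seq_norm :: "real \<Rightarrow> (nat \<Rightarrow> 'k :: real_normed_field) \<Rightarrow> real" where
  "seq_norm s x = (\<Sum>i. norm (x i) powr s) powr (1 / s)"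

definition seq_space :: "real \<Rightarrow> ('k :: {real_normed_field, banach}, nat \<Rightarrow> 'k) normed_module" where
  "seq_space s = \<lparr>carrier = {x. summable (\<lambda>i. norm (x i) powr s)}, mult = (\<lambda>x y i. x i * y i), one = (\<lambda>i. 1),
     zero = (\<lambda>i. 0), add = (\<lambda>x y i. x i + y i), smult = (\<lambda>a x i. a * x i), vnorm = seq_norm s\<rparr>"

lemma seq_space_simps [simp]:
  "x \<in> carrier (seq_space s) \<longleftrightarrow> summable (\<lambda>i. norm (x i) powr s)"
  "\<zero>\<^bsub>seq_space s\<^esub> = (\<lambda>i. 0)"
  "x \<oplus>\<^bsub>seq_space s\<^esub> y = (\<lambda>i. x i + y i)"
  "a \<odot>\<^bsub>seq_space s\<^esub> x = (\<lambda>i. a * x i)"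
  "vnorm (seq_space s) = seq_norm s"
  by (simp_all add: seq_space_def)

lemma scalars_simps [simp]:
  "carrier scalars = UNIV" "\<zero>\<^bsub>scalars\<^esub> = 0" "x \<oplus>\<^bsub>scalars\<^esub> y = x + y"
  "a \<odot>\<^bsub>scalars\<^esub> x = a * x" "vnorm scalars = norm" "\<one>\<^bsub>scalars\<^esub> = 1" "a \<otimes>\<^bsub>scalars\<^esub> b = a * b"
  by (simp_all add: scalars_def)

lemma seq_norm_nonneg: "0 \<le> seq_norm s x"
  by (simp add: seq_norm_def)

lemma partial_sum_le_seq_norm:
  assumes "0 < s" "x \<in> carrier (seq_space s)" "finite F"
  shows "(\<Sum>i\<in>F. norm (x i) powr s) \<le> seq_norm s x powr s"
proof -
  have "(\<Sum>i\<in>F. norm (x i) powr s) \<le> (\<Sum>i. norm (x i) powr s)"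
    using assms by (intro sum_le_suminf) auto
  then show ?thesis
    using assms(1) by (simp add: seq_norm_def powr_powr suminf_nonneg[OF assms(2)[simplified]])
qed

text \<open>
  With \<open>partial_sum_le_seq_norm\<close>, this replaces every statement about the infinite sum by a uniform
  statement about finite partial sums, where Minkowski's inequality and passage to limits are
  elementary.
\<close>

lemma seq_norm_leI:
  assumes s: "0 < s" and c: "0 \<le> c" and le: "\<And>N. (\<Sum>i<N. norm (x i) powr s) \<le> c powr s"
  shows "x \<in> carrier (seq_space s)" "seq_norm s x \<le> c"
proof -
  have sm: "summable (\<lambda>i. norm (x i) powr s)"
    by (rule bounded_imp_summable[where B = "c powr s"]) (use le lessThan_Suc_atMost in \<open>metis powr_ge_zero\<close>)+
  then show "x \<in> carrier (seq_space s)" by simp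
  have "(\<Sum>i. norm (x i) powr s) \<le> c powr s"
    using sm le by (intro suminf_le_const)
  then have "seq_norm s x \<le> (c powr s) powr (1 / s)"
    using s sm unfolding seq_norm_def by (intro powr_mono2 suminf_nonneg) auto
  then show "seq_norm s x \<le> c" using s c by (simp add: powr_powr)
qed

lemma norm_coordinate_le:
  assumes "0 < s" "x \<in> carrier (seq_space s)"
  shows "norm (x i) \<le> seq_norm s x"
  using partial_sum_le_seq_norm[OF assms, of "{i}"] seq_norm_nonneg[of s x]
    powr_less_mono2[OF assms(1), of "seq_norm s x" "norm (x i)"] by force

text \<open>
  Convexity of \<open>t \<mapsto> t\<^sup>s\<close> on the closed half-line. Convexity on the open half-line covers all cases but
  those with a vanishing argument, and for these the claim reduces to \<open>w\<^sup>s \<le> w\<close> on \<open>[0, 1]\<close>.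
\<close>

lemma powr_convex_combination:
  fixes u v a b s :: real
  assumes "1 \<le> s" "0 \<le> a" "0 \<le> b" "0 \<le> u" "0 \<le> v" "u + v = 1"
  shows "(u * a + v * b) powr s \<le> u * a powr s + v * b powr s"
proof -
  have small: "(w * c) powr s \<le> w * c powr s" if "0 \<le> w" "w \<le> 1" "0 \<le> c" for w c
    using that assms(1) powr_le_one_le[of w s] by (cases "w = 0") (auto simp: powr_mult intro!: mult_right_mono)
  show ?thesis
  proof (cases "a = 0 \<or> b = 0")
    case True
    then show ?thesis using assms small[of u a] small[of v b] by auto
  next
    case False
    then show ?thesis
      using convex_onD[OF powr_convex[OF assms(1)], of v a b] assms
      by (simp add: algebra_simps flip: eq_diff_eq)
  qed
qed

text \<open>
  Minkowski's inequality, as convexity of the unit ball: \<open>(x + y) / (a + b)\<close> is the convex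
  combination of \<open>x / a\<close> and \<open>y / b\<close> with weights \<open>u = a / (a + b)\<close> and \<open>v = b / (a + b)\<close>, and
  the \<open>s\<close>-th power is convex in each coordinate. The division is the reason for asking \<open>a\<close> and \<open>b\<close> to
  be positive; the triangle inequality for the norms follows by enlarging both norms by an
  arbitrary \<open>e > 0\<close>.
\<close>

lemma partial_sum_add_le:
  fixes x y :: "nat \<Rightarrow> 'k :: real_normed_field"
  assumes s: "1 \<le> s" and ab: "0 < a" "0 < b" and "finite F"
    and x: "(\<Sum>i\<in>F. norm (x i) powr s) \<le> a powr s"
    and y: "(\<Sum>i\<in>F. norm (y i) powr s) \<le> b powr s"
  shows "(\<Sum>i\<in>F. norm (x i + y i) powr s) \<le> (a + b) powr s"
proof -
  define u v where "u = a / (a + b)" and "v = b / (a + b)"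
  have uv: "0 \<le> u" "0 \<le> v" "u + v = 1"
    using ab by (auto simp: u_def v_def divide_simps)
  have "norm (x i + y i) powr s \<le> (a + b) powr s * (u * (norm (x i) powr s / a powr s) +
      v * (norm (y i) powr s / b powr s))" for i
  proof -
    have "norm (x i + y i) \<le> (a + b) * (u * (norm (x i) / a) + v * (norm (y i) / b))"
    proof -
      have "(a + b) * u = a" "(a + b) * v = b" using ab by (simp_all add: u_def v_def)
      then have "(a + b) * (u * (norm (x i) / a) + v * (norm (y i) / b)) = norm (x i) + norm (y i)"
        using ab by (simp add: distrib_left flip: mult.assoc)
      then show ?thesis using norm_triangle_ineq[of "x i" "y i"] by simp
    qed
    then have "norm (x i + y i) powr s \<le> ((a + b) * (u * (norm (x i) / a) + v * (norm (y i) / b))) powr s"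
      using s by (intro powr_mono2) auto
    also have "\<dots> = (a + b) powr s * (u * (norm (x i) / a) + v * (norm (y i) / b)) powr s"
      using ab uv by (intro powr_mult)
    also have "\<dots> \<le> (a + b) powr s * (u * (norm (x i) / a) powr s + v * (norm (y i) / b) powr s)"
      using s ab uv by (intro mult_left_mono powr_convex_combination) auto
    finally show ?thesis using ab by (simp add: powr_divide)
  qed
  then have "(\<Sum>i\<in>F. norm (x i + y i) powr s) \<le> (\<Sum>i\<in>F. (a + b) powr s *
      (u * (norm (x i) powr s / a powr s) + v * (norm (y i) powr s / b powr s)))"
    by (intro sum_mono)
  also have "\<dots> = (a + b) powr s * (u * ((\<Sum>i\<in>F. norm (x i) powr s) / a powr s) +
      v * ((\<Sum>i\<in>F. norm (y i) powr s) / b powr s))"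
    by (simp add: sum_distrib_left sum.distrib sum_divide_distrib distrib_left)
  also have "\<dots> \<le> (a + b) powr s * (u * 1 + v * 1)"
    using x y ab uv by (intro mult_left_mono add_mono) (auto simp: divide_le_eq)
  finally show ?thesis using uv by simp
qed

lemma seq_space_add:
  assumes s: "1 \<le> s" and x: "x \<in> carrier (seq_space s)" and y: "y \<in> carrier (seq_space s)"
  shows "(\<lambda>i. x i + y i) \<in> carrier (seq_space s)"
    and "seq_norm s (\<lambda>i. x i + y i) \<le> seq_norm s x + seq_norm s y"
proof -
  let ?c = "\<lambda>e. (seq_norm s x + e) + (seq_norm s y + e)"
  have "(\<Sum>i<N. norm (x i + y i) powr s) \<le> ?c e powr s" if e: "0 < e" for e N
  proof (rule partial_sum_add_le[OF s])
    have "(\<Sum>i<N. norm (z i) powr s) \<le> (seq_norm s z + e) powr s"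
      if "z \<in> carrier (seq_space s)" for z :: "nat \<Rightarrow> 'a"
    proof -
      have "seq_norm s z powr s \<le> (seq_norm s z + e) powr s"
        using s e seq_norm_nonneg[of s z] by (intro powr_mono2) auto
      then show ?thesis
        using partial_sum_le_seq_norm[OF _ that, of "{..<N}"] s by auto
    qed
    then show "(\<Sum>i<N. norm (x i) powr s) \<le> (seq_norm s x + e) powr s"
      "(\<Sum>i<N. norm (y i) powr s) \<le> (seq_norm s y + e) powr s"
      using x y by blast+
  qed (use e seq_norm_nonneg[of s] in \<open>auto intro: add_nonneg_pos\<close>)
  note bound = seq_norm_leI[OF _ _ this]
  show "(\<lambda>i. x i + y i) \<in> carrier (seq_space s)"
    using s by (intro bound(1)[of 1]) (auto intro!: add_nonneg_nonneg seq_norm_nonneg)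
  have "seq_norm s (\<lambda>i. x i + y i) \<le> seq_norm s x + seq_norm s y + e" if "0 < e" for e
    using bound(2)[of "e / 2"] that s seq_norm_nonneg[of s x] seq_norm_nonneg[of s y] by auto
  then show "seq_norm s (\<lambda>i. x i + y i) \<le> seq_norm s x + seq_norm s y"
    by (rule field_le_epsilon)
qed

lemma seq_space_scale:
  assumes s: "0 < s" and x: "x \<in> carrier (seq_space s)"
  shows "(\<lambda>i. a * x i) \<in> carrier (seq_space s)"
    and "seq_norm s (\<lambda>i. a * x i) = norm a * seq_norm s x"
proof -
  have eq: "norm (a * x i) powr s = norm a powr s * norm (x i) powr s" for i
    by (simp add: norm_mult powr_mult)
  show "(\<lambda>i. a * x i) \<in> carrier (seq_space s)"
    using x by (simp add: eq summable_mult)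
  have "(\<Sum>i. norm (a * x i) powr s) = norm a powr s * (\<Sum>i. norm (x i) powr s)"
    unfolding eq using x by (intro suminf_mult) simp
  then show "seq_norm s (\<lambda>i. a * x i) = norm a * seq_norm s x"
    using s x by (simp add: seq_norm_def powr_mult powr_powr suminf_nonneg)
qed

lemma cring_scalars: "cring (scalars :: ('k :: {real_normed_field, banach}, 'k) normed_module)"
proof (rule cringI)
  show "abelian_group (scalars :: ('k, 'k) normed_module)"
    by (rule abelian_groupI) (auto intro: exI[of _ "- x" for x])
  show "Group.comm_monoid (scalars :: ('k, 'k) normed_module)"
    by (rule comm_monoidI) auto
qed (auto simp: algebra_simps)

lemma normed_space_scalars:
  "normed_space (scalars :: ('k :: {real_normed_field, banach}, 'k) normed_module)"
proof (intro normed_space.intro moduleI cring_scalars)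
  show "abelian_group (scalars :: ('k, 'k) normed_module)"
    by (rule abelian_groupI) (auto intro: exI[of _ "- x" for x])
qed (auto simp: algebra_simps normed_space_axioms_def norm_mult norm_triangle_ineq)

lemma normed_space_seq_space:
  assumes s: "1 \<le> s"
  shows "normed_space (seq_space s :: ('k :: {real_normed_field, banach}, nat \<Rightarrow> 'k) normed_module)"
proof (intro normed_space.intro moduleI cring_scalars)
  show "abelian_group (seq_space s :: ('k, nat \<Rightarrow> 'k) normed_module)"
  proof (rule abelian_groupI)
    show "\<exists>y\<in>carrier (seq_space s). y \<oplus>\<^bsub>seq_space s\<^esub> x = \<zero>\<^bsub>seq_space s\<^esub>"
      if "x \<in> carrier (seq_space s)" for x :: "nat \<Rightarrow> 'k"
      using that by (intro bexI[of _ "\<lambda>i. - x i"]) auto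
  qed (use seq_space_add(1)[OF s] in \<open>auto simp: algebra_simps\<close>)
  show "normed_space_axioms (seq_space s :: ('k, nat \<Rightarrow> 'k) normed_module)"
  proof
    fix x y :: "nat \<Rightarrow> 'k" and a
    assume x: "x \<in> carrier (seq_space s)"
    show "0 \<le> vnorm (seq_space s) x" by (simp add: seq_norm_nonneg)
    show "vnorm (seq_space s) (a \<odot>\<^bsub>seq_space s\<^esub> x) = norm a * vnorm (seq_space s) x"
      using seq_space_scale(2)[OF _ x] s by simp
    show "x = \<zero>\<^bsub>seq_space s\<^esub>" if "vnorm (seq_space s) x = 0"
      using norm_coordinate_le[OF _ x] that s by auto
    show "vnorm (seq_space s) (x \<oplus>\<^bsub>seq_space s\<^esub> y) \<le> vnorm (seq_space s) x + vnorm (seq_space s) y"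
      if "y \<in> carrier (seq_space s)"
      using seq_space_add(2)[OF s x that] by simp
  qed
qed (use s seq_space_scale(1)[of s] in \<open>auto simp: algebra_simps\<close>)

lemma seq_space_minus:
  assumes s: "1 \<le> s" and y: "y \<in> carrier (seq_space s)"
  shows "x \<ominus>\<^bsub>seq_space s\<^esub> y = (\<lambda>i. x i - y i)"
proof -
  interpret normed_space "seq_space s :: ('a, nat \<Rightarrow> 'a) normed_module"
    by (rule normed_space_seq_space[OF s])
  have "\<ominus>\<^bsub>seq_space s\<^esub> y = (\<lambda>i. - y i)" using y by (intro M.minus_equality) auto
  then show ?thesis by (simp add: a_minus_def)
qed

text \<open>
  A Cauchy sequence converges in each coordinate. Its partial-sum estimates pass to the coordinatewise
  limit, and uniformly in the length of the partial sum, which gives convergence in norm.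
\<close>

lemma banach_space_seq_space:
  assumes s: "1 \<le> s"
  shows "banach_space (seq_space s :: ('k :: {real_normed_field, banach}, nat \<Rightarrow> 'k) normed_module)"
proof -
  let ?X = "seq_space s :: ('k, nat \<Rightarrow> 'k) normed_module"
  interpret X: normed_space ?X by (rule normed_space_seq_space[OF s])
  interpret M: Metric_space "carrier ?X" "vdist ?X" by (rule X.Metric_space_vdist)
  have s0: "0 < s" using s by simp
  have dist: "vdist ?X x y = seq_norm s (\<lambda>i. x i - y i)"
    if "x \<in> carrier ?X" "y \<in> carrier ?X" for x y
    using that seq_space_minus[OF s that(2), of x] by (simp add: vdist_def)
  have diff: "(\<lambda>i. x i - y i) \<in> carrier ?X" if "x \<in> carrier ?X" "y \<in> carrier ?X" for x y
    using X.M.minus_closed[OF that] unfolding seq_space_minus[OF s that(2)] .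
  have "\<exists>y. limitin M.mtopology x y sequentially" if "M.MCauchy x" for x
  proof -
    have xc: "x n \<in> carrier ?X" for n using that unfolding M.MCauchy_def by blast
    have cauchy: "\<exists>N. \<forall>m\<ge>N. \<forall>n\<ge>N. seq_norm s (\<lambda>i. x m i - x n i) < e" if "0 < e" for e
    proof -
      have "\<exists>N. \<forall>m n. N \<le> m \<longrightarrow> N \<le> n \<longrightarrow> vdist ?X (x m) (x n) < e"
        using \<open>M.MCauchy x\<close> that unfolding M.MCauchy_def by blast
      then show ?thesis unfolding dist[OF xc xc] by blast
    qed
    have "Cauchy (\<lambda>n. x n i)" for i
    proof (rule metric_CauchyI)
      fix e :: real assume "0 < e"
      then obtain N where "\<forall>m\<ge>N. \<forall>n\<ge>N. seq_norm s (\<lambda>i. x m i - x n i) < e" using cauchy by blast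
      moreover have "dist (x m i) (x n i) \<le> seq_norm s (\<lambda>i. x m i - x n i)" for m n
        using norm_coordinate_le[OF s0 diff[OF xc xc]] by (simp add: dist_norm)
      ultimately show "\<exists>N. \<forall>m\<ge>N. \<forall>n\<ge>N. dist (x m i) (x n i) < e"
        by (meson le_less_trans)
    qed
    then have "\<forall>i. \<exists>l. (\<lambda>n. x n i) \<longlonglongrightarrow> l"
      by (simp add: Cauchy_convergent_iff convergent_def)
    then obtain y where y: "(\<lambda>n. x n i) \<longlonglongrightarrow> y i" for i
      by metis
    have lim: "\<exists>N. \<forall>m\<ge>N. (\<lambda>i. x m i - y i) \<in> carrier ?X \<and> seq_norm s (\<lambda>i. x m i - y i) \<le> e"
      if "0 < e" for e
    proof -
      obtain N where N: "\<And>m n. m \<ge> N \<Longrightarrow> n \<ge> N \<Longrightarrow> seq_norm s (\<lambda>i. x m i - x n i) < e"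
        using cauchy[OF \<open>0 < e\<close>] by blast
      have "(\<Sum>i<K. norm (x m i - y i) powr s) \<le> e powr s" if "m \<ge> N" for m K
      proof (rule LIMSEQ_le_const2)
        show "(\<lambda>n. \<Sum>i<K. norm (x m i - x n i) powr s) \<longlonglongrightarrow> (\<Sum>i<K. norm (x m i - y i) powr s)"
          using s0 by (intro tendsto_sum tendsto_powr' tendsto_norm tendsto_diff tendsto_const y) auto
        have "(\<Sum>i<K. norm (x m i - x n i) powr s) \<le> e powr s" if "n \<ge> N" for n
        proof -
          have "(\<Sum>i<K. norm (x m i - x n i) powr s) \<le> seq_norm s (\<lambda>i. x m i - x n i) powr s"
            by (rule partial_sum_le_seq_norm[OF s0 diff[OF xc xc]]) simp
          also have "\<dots> \<le> e powr s"
            using N[OF \<open>m \<ge> N\<close> that] s0 by (intro powr_mono2 seq_norm_nonneg) auto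
          finally show ?thesis .
        qed
        then show "\<exists>N. \<forall>n\<ge>N. (\<Sum>i<K. norm (x m i - x n i) powr s) \<le> e powr s" by blast
      qed
      then have "(\<lambda>i. x m i - y i) \<in> carrier ?X \<and> seq_norm s (\<lambda>i. x m i - y i) \<le> e" if "m \<ge> N" for m
        using that \<open>0 < e\<close> by (intro conjI seq_norm_leI[OF s0, of e]) auto
      then show ?thesis by blast
    qed
    have yc: "y \<in> carrier ?X"
    proof -
      obtain m where "(\<lambda>i. x m i - y i) \<in> carrier ?X" using lim[OF zero_less_one] by blast
      from diff[OF xc[of m] this] show ?thesis by simp
    qed
    have "limitin M.mtopology x y sequentially"
      unfolding M.limitin_metric eventually_sequentially
    proof (intro conjI yc allI impI)
      fix e :: real assume e: "0 < e"
      have "0 < e / 2" using e by simp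
      then obtain N where N: "\<And>m. m \<ge> N \<Longrightarrow> seq_norm s (\<lambda>i. x m i - y i) \<le> e / 2"
        using lim by blast
      have "x m \<in> carrier ?X \<and> vdist ?X (x m) y < e" if "m \<ge> N" for m
        unfolding dist[OF xc yc] using N[OF that] e xc by (intro conjI) auto
      then show "\<exists>N. \<forall>n\<ge>N. x n \<in> carrier ?X \<and> vdist ?X (x n) y < e" by blast
    qed
    then show ?thesis by blast
  qed
  then show ?thesis
    by (intro banach_space.intro banach_space_axioms.intro X.normed_space_axioms)
      (simp add: M.mcomplete_def del: seq_space_simps)
qed

section \<open>Bounded operators and finite sums\<close>

text \<open>
  Both the operator norm and the distance of operators are suprema over the unit ball only. This
  rescaling carries such bounds to all vectors; it is stated for a functional \<open>\<phi>\<close> because it is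
  needed for \<open>\<parallel>T x\<parallel>\<close> as well as for \<open>\<parallel>S x - T x\<parallel>\<close>.
\<close>

lemma homogeneous_bound:
  fixes X :: "('k :: {real_normed_field, banach}, 'a) normed_module"
  assumes X: "normed_space X"
    and hom: "\<And>a x. x \<in> carrier X \<Longrightarrow> \<phi> (a \<odot>\<^bsub>X\<^esub> x) = norm a * \<phi> x"
    and le: "\<And>x. x \<in> carrier X \<Longrightarrow> vnorm X x \<le> 1 \<Longrightarrow> \<phi> x \<le> M"
    and x: "x \<in> carrier X"
  shows "\<phi> x \<le> M * vnorm X x"
proof -
  interpret X: normed_space X by fact
  show ?thesis
  proof (cases "vnorm X x = 0")
    case True
    then have "x = 0 \<odot>\<^bsub>X\<^esub> x"
      using X.vnorm_eq_zero[OF x] X.smult_l_null[OF x] by simp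
    then have "\<phi> x = 0" using hom[OF x, of 0] by simp
    with True show ?thesis by simp
  next
    case False
    define c where "c = vnorm X x"
    have c: "0 < c" using False X.vnorm_nonneg[OF x] by (simp add: c_def)
    define a :: 'k where "a = of_real (1 / c)"
    have a: "norm a = 1 / c" using c by (simp add: a_def norm_divide)
    have "a \<odot>\<^bsub>X\<^esub> x \<in> carrier X" "vnorm X (a \<odot>\<^bsub>X\<^esub> x) = 1"
      using X.smult_closed[of a x] X.vnorm_smult[OF x, of a] x a c by (auto simp: c_def)
    then have "\<phi> x / c \<le> M" using le[of "a \<odot>\<^bsub>X\<^esub> x"] hom[OF x, of a] a by simp
    then show ?thesis using c by (simp add: c_def field_simps)
  qed
qed

lemma operator_norm_bound:
  fixes X :: "('k :: {real_normed_field, banach}, 'a) normed_module"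
  assumes "normed_space X" "normed_space Y" "T \<in> operators X Y"
  obtains K where "\<And>x. x \<in> carrier X \<Longrightarrow> vnorm Y (T x) \<le> K * vnorm X x"
proof -
  interpret Y: normed_space Y by fact
  obtain K where K: "\<And>x. x \<in> carrier X \<Longrightarrow> vnorm X x \<le> 1 \<Longrightarrow> vnorm Y (T x) \<le> K"
    using operators_bounded[OF assms] by blast
  have "vnorm Y (T (a \<odot>\<^bsub>X\<^esub> x)) = norm a * vnorm Y (T x)" if "x \<in> carrier X" for a x
    using assms(3) that Y.vnorm_smult by (auto simp: operators_def)
  from homogeneous_bound[where \<phi> = "\<lambda>x. vnorm Y (T x)", OF assms(1) this K] that show thesis by blast
qed

text \<open>
  The supremum in \<open>opdist\<close> has to be shown to range over a bounded set before it bounds its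
  elements; the sum of bounds for \<open>S\<close> and \<open>T\<close> on the unit ball does this.
\<close>

lemma operator_diff_le_opdist:
  fixes X :: "('k :: {real_normed_field, banach}, 'a) normed_module"
  assumes X: "normed_space X" and Y: "normed_space Y"
    and S: "S \<in> operators X Y" and T: "T \<in> operators X Y" and x: "x \<in> carrier X"
  shows "vnorm Y (S x \<ominus>\<^bsub>Y\<^esub> T x) \<le> opdist X Y S T * vnorm X x"
proof (rule homogeneous_bound[OF X _ _ x])
  interpret X: normed_space X by fact
  interpret Y: normed_space Y by fact
  have cl: "S x \<in> carrier Y" "T x \<in> carrier Y" if "x \<in> carrier X" for x
    using S T that by (auto simp: operators_def)
  show "vnorm Y (S (a \<odot>\<^bsub>X\<^esub> x) \<ominus>\<^bsub>Y\<^esub> T (a \<odot>\<^bsub>X\<^esub> x)) = norm a * vnorm Y (S x \<ominus>\<^bsub>Y\<^esub> T x)"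
    if x: "x \<in> carrier X" for a x
  proof -
    have "S (a \<odot>\<^bsub>X\<^esub> x) \<ominus>\<^bsub>Y\<^esub> T (a \<odot>\<^bsub>X\<^esub> x) = a \<odot>\<^bsub>Y\<^esub> S x \<ominus>\<^bsub>Y\<^esub> a \<odot>\<^bsub>Y\<^esub> T x"
      using S T x by (simp add: operators_def)
    also have "\<dots> = a \<odot>\<^bsub>Y\<^esub> (S x \<ominus>\<^bsub>Y\<^esub> T x)"
      using cl[OF x] by (simp add: a_minus_def Y.smult_r_distr Y.smult_r_minus)
    finally show ?thesis using Y.vnorm_smult cl[OF x] by simp
  qed
  obtain K where K: "\<And>x. x \<in> carrier X \<Longrightarrow> vnorm X x \<le> 1 \<Longrightarrow> vnorm Y (S x) \<le> K"
    using operators_bounded[OF X Y S] by blast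
  obtain L where L: "\<And>x. x \<in> carrier X \<Longrightarrow> vnorm X x \<le> 1 \<Longrightarrow> vnorm Y (T x) \<le> L"
    using operators_bounded[OF X Y T] by blast
  let ?B = "{x \<in> carrier X. vnorm X x \<le> 1}"
  have "vnorm Y (S x \<ominus>\<^bsub>Y\<^esub> T x) \<le> K + L" if x: "x \<in> ?B" for x
  proof -
    have c: "S x \<in> carrier Y" "T x \<in> carrier Y" using x cl by auto
    have "vnorm Y (S x \<ominus>\<^bsub>Y\<^esub> T x) \<le> vnorm Y (S x) + vnorm Y (T x)"
      using Y.minus_triangle[of "S x" "\<zero>\<^bsub>Y\<^esub>" "T x"] Y.vnorm_minus_commute[of "\<zero>\<^bsub>Y\<^esub>" "T x"] c
      by (simp add: Y.minus_zero_right)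
    then show ?thesis using K[of x] L[of x] x by force
  qed
  then have bdd: "bdd_above ((\<lambda>x. vnorm Y (S x \<ominus>\<^bsub>Y\<^esub> T x)) ` ?B)"
    by (auto simp: bdd_above_def)
  have eq: "opdist X Y S T = (SUP x\<in>?B. vnorm Y (S x \<ominus>\<^bsub>Y\<^esub> T x))"
    using S T by (auto simp: opdist_def opnorm_def intro!: SUP_cong)
  show "vnorm Y (S x \<ominus>\<^bsub>Y\<^esub> T x) \<le> opdist X Y S T" if "x \<in> carrier X" "vnorm X x \<le> 1" for x
    unfolding eq using that bdd by (intro cSUP_upper) auto
qed

lemma bounded_linear_in_operators:
  fixes X :: "('k :: {real_normed_field, banach}, 'a) normed_module"
  assumes X: "normed_space X" and Y: "normed_space Y"
    and TE: "T \<in> carrier X \<rightarrow>\<^sub>E carrier Y"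
    and add: "\<And>x y. x \<in> carrier X \<Longrightarrow> y \<in> carrier X \<Longrightarrow> T (x \<oplus>\<^bsub>X\<^esub> y) = T x \<oplus>\<^bsub>Y\<^esub> T y"
    and scale: "\<And>a x. x \<in> carrier X \<Longrightarrow> T (a \<odot>\<^bsub>X\<^esub> x) = a \<odot>\<^bsub>Y\<^esub> T x"
    and le: "\<And>x. x \<in> carrier X \<Longrightarrow> vnorm Y (T x) \<le> vnorm X x"
  shows "T \<in> operators X Y"
proof -
  interpret X: normed_space X by fact
  interpret Y: normed_space Y by fact
  interpret MX: Metric_space "carrier X" "vdist X" by (rule X.Metric_space_vdist)
  interpret MY: Metric_space "carrier Y" "vdist Y" by (rule Y.Metric_space_vdist)
  have cl: "T x \<in> carrier Y" if "x \<in> carrier X" for x using TE that by auto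
  have diff: "T x \<ominus>\<^bsub>Y\<^esub> T y = T (x \<ominus>\<^bsub>X\<^esub> y)" if xy: "x \<in> carrier X" "y \<in> carrier X" for x y
  proof -
    have "T x = T ((x \<ominus>\<^bsub>X\<^esub> y) \<oplus>\<^bsub>X\<^esub> y)"
      using xy by (simp add: a_minus_def X.M.a_assoc X.M.l_neg)
    also have "\<dots> = T (x \<ominus>\<^bsub>X\<^esub> y) \<oplus>\<^bsub>Y\<^esub> T y" using xy by (intro add) auto
    finally show ?thesis
      using xy cl[of "x \<ominus>\<^bsub>X\<^esub> y"] cl[of y] by (simp add: a_minus_def Y.M.a_assoc Y.M.r_neg)
  qed
  have "vdist Y (T x) (T y) \<le> vdist X x y" if "x \<in> carrier X" "y \<in> carrier X" for x y
    using that cl le[of "x \<ominus>\<^bsub>X\<^esub> y"] by (simp add: vdist_def diff)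
  then have "continuous_map (norm_topology X) (norm_topology Y) T"
    unfolding MX.metric_continuous_map[OF MY.Metric_space_axioms] using cl
    by (meson image_subsetI le_less_trans)
  then show ?thesis using TE add scale by (auto simp: operators_def)
qed

lemma operators_finsum:
  assumes X: "normed_space X" and Y: "normed_space Y" and T: "T \<in> operators X Y"
    and "finite F" "\<And>k. k \<in> F \<Longrightarrow> g k \<in> carrier X"
  shows "T (\<Oplus>\<^bsub>X\<^esub>k\<in>F. g k) = (\<Oplus>\<^bsub>Y\<^esub>k\<in>F. T (g k))"
proof -
  interpret X: normed_space X by fact
  interpret Y: normed_space Y by fact
  have cl: "T x \<in> carrier Y" if "x \<in> carrier X" for x using T that by (auto simp: operators_def)
  have add: "T (x \<oplus>\<^bsub>X\<^esub> y) = T x \<oplus>\<^bsub>Y\<^esub> T y" if "x \<in> carrier X" "y \<in> carrier X" for x y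
    using T that by (auto simp: operators_def)
  show ?thesis using assms(4,5)
  proof (induction F rule: finite_induct)
    case (insert k F)
    then have "(\<Oplus>\<^bsub>X\<^esub>j\<in>F. g j) \<in> carrier X" by (intro X.M.finsum_closed) auto
    with insert show ?case by (simp add: cl add X.M.finsum_insert Y.M.finsum_insert Pi_iff)
  qed (simp add: operators_zero[OF X Y T])
qed

lemma finsum_scalars:
  fixes g :: "'a \<Rightarrow> 'k :: {real_normed_field, banach}"
  assumes "finite F"
  shows "(\<Oplus>\<^bsub>scalars\<^esub>k\<in>F. g k) = (\<Sum>k\<in>F. g k)"
proof -
  interpret normed_space "scalars :: ('k, 'k) normed_module" by (rule normed_space_scalars)
  show ?thesis using assms
    by (induction F rule: finite_induct) (auto simp: R.finsum_insert)
qed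

lemma finsum_seq_space:
  fixes g :: "'a \<Rightarrow> nat \<Rightarrow> 'k :: {real_normed_field, banach}"
  assumes s: "1 \<le> s" and "finite F" "\<And>k. k \<in> F \<Longrightarrow> g k \<in> carrier (seq_space s)"
  shows "(\<Oplus>\<^bsub>seq_space s\<^esub>k\<in>F. g k) = (\<lambda>i. \<Sum>k\<in>F. g k i)"
proof -
  interpret normed_space "seq_space s :: ('k, nat \<Rightarrow> 'k) normed_module"
    by (rule normed_space_seq_space[OF s])
  show ?thesis using assms(2,3)
  proof (induction F rule: finite_induct)
    case (insert k F)
    have "(\<Oplus>\<^bsub>seq_space s\<^esub>j\<in>insert k F. g j) = g k \<oplus>\<^bsub>seq_space s\<^esub> (\<Oplus>\<^bsub>seq_space s\<^esub>j\<in>F. g j)"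
      using insert.hyps insert.prems by (intro M.finsum_insert) blast+
    then show ?case using insert by simp
  qed simp
qed

lemma seq_space_sum:
  assumes s: "1 \<le> s" and "finite F" "\<And>k. k \<in> F \<Longrightarrow> g k \<in> carrier (seq_space s)"
  shows "(\<lambda>i. \<Sum>k\<in>F. g k i) \<in> carrier (seq_space s) \<and>
    seq_norm s (\<lambda>i. \<Sum>k\<in>F. g k i) \<le> (\<Sum>k\<in>F. seq_norm s (g k))"
  using assms(2,3)
proof (induction F rule: finite_induct)
  case empty
  show ?case by (simp add: seq_norm_def)
next
  case (insert k F)
  note IH = insert.IH[OF insert.prems[OF insertI2]]
  show ?case
    using seq_space_add[OF s insert.prems[OF insertI1] conjunct1[OF IH]] conjunct2[OF IH] insert.hyps
    by simp
qed

lemma identity_in_operators: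
  assumes "normed_space X"
  shows "(\<lambda>x\<in>carrier X. x) \<in> operators X X"
proof -
  interpret X: normed_space X by fact
  show ?thesis using assms by (intro bounded_linear_in_operators) auto
qed

lemma coordinate_in_operators:
  assumes s: "1 \<le> s"
  shows "(\<lambda>x\<in>carrier (seq_space s). x i) \<in> operators (seq_space s) scalars"
proof -
  note ns = normed_space_seq_space[OF s]
  show ?thesis
  proof (rule bounded_linear_in_operators[OF ns normed_space_scalars])
    fix x y :: "nat \<Rightarrow> 'a" and a
    assume x: "x \<in> carrier (seq_space s)"
    show "vnorm scalars ((\<lambda>x\<in>carrier (seq_space s). x i) x) \<le> vnorm (seq_space s) x"
      using norm_coordinate_le[OF _ x] s x by simp
    show "(\<lambda>x\<in>carrier (seq_space s). x i) (a \<odot>\<^bsub>seq_space s\<^esub> x) =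
        a \<odot>\<^bsub>scalars\<^esub> (\<lambda>x\<in>carrier (seq_space s). x i) x"
      using seq_space_scale(1)[OF _ x] s x by simp
    show "(\<lambda>x\<in>carrier (seq_space s). x i) (x \<oplus>\<^bsub>seq_space s\<^esub> y) =
        (\<lambda>x\<in>carrier (seq_space s). x i) x \<oplus>\<^bsub>scalars\<^esub> (\<lambda>x\<in>carrier (seq_space s). x i) y"
      if "y \<in> carrier (seq_space s)"
      using seq_space_add(1)[OF s x that] that x by simp
  qed auto
qed

section \<open>The unit vectors of \<open>\<ell>\<^sub>s\<close>\<close>

lemma seq_norm_finite_support:
  assumes "finite F" "\<And>i. i \<notin> F \<Longrightarrow> x i = 0"
  shows "x \<in> carrier (seq_space s)" "seq_norm s x = (\<Sum>i\<in>F. norm (x i) powr s) powr (1 / s)"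
proof -
  have "norm (x i) powr s = 0" if "i \<notin> F" for i using assms(2)[OF that] by simp
  note this [simp]
  show "x \<in> carrier (seq_space s)"
    using summable_finite[OF assms(1), of "\<lambda>i. norm (x i) powr s"] by simp
  show "seq_norm s x = (\<Sum>i\<in>F. norm (x i) powr s) powr (1 / s)"
    using suminf_finite[OF assms(1), of "\<lambda>i. norm (x i) powr s"] by (simp add: seq_norm_def)
qed

definition unit_vec :: "nat \<Rightarrow> nat \<Rightarrow> 'k :: real_normed_field" where
  "unit_vec n i = of_bool (i = n)"

lemma seq_norm_unit_combination:
  assumes "finite F"
  shows "(\<lambda>i. \<Sum>n\<in>F. a n * unit_vec n i) \<in> carrier (seq_space s)"
    and "seq_norm s (\<lambda>i. \<Sum>n\<in>F. a n * unit_vec n i) = (\<Sum>n\<in>F. norm (a n) powr s) powr (1 / s)"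
proof -
  have eq: "(\<Sum>n\<in>F. a n * unit_vec n i) = (if i \<in> F then a i else 0)" for i
    using assms(1) by (simp add: unit_vec_def if_distrib sum.delta eq_commute[of i] flip: of_bool_def cong: if_cong)
  show "(\<lambda>i. \<Sum>n\<in>F. a n * unit_vec n i) \<in> carrier (seq_space s)"
    using assms(1) by (intro seq_norm_finite_support(1)) (auto simp: eq)
  show "seq_norm s (\<lambda>i. \<Sum>n\<in>F. a n * unit_vec n i) = (\<Sum>n\<in>F. norm (a n) powr s) powr (1 / s)"
    using seq_norm_finite_support(2)[OF assms(1), of "\<lambda>i. \<Sum>n\<in>F. a n * unit_vec n i" s] by (simp add: eq)
qed

lemma seq_norm_unit_vec:
  shows "(unit_vec n :: nat \<Rightarrow> 'k :: {real_normed_field, banach}) \<in> carrier (seq_space s)"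
    and "seq_norm s (unit_vec n :: nat \<Rightarrow> 'k) = 1"
  using seq_norm_unit_combination[where F = "{n}" and a = "\<lambda>_. 1 :: 'k"] by auto

text \<open>
  Every contradiction below arises by comparing two powers of the number \<open>m\<close> of vectors that are
  added up. The bound \<open>2 \<le> m\<close> lets \<open>{m..<2 * m}\<close> enter all Schreier families.
\<close>

lemma powr_dominated:
  fixes a b c K :: real
  assumes "a < b" "0 < c"
  obtains m :: nat where "2 \<le> m" "K * real m powr a < c * real m powr b"
proof -
  have "filterlim (\<lambda>m. real m powr (b - a)) at_top sequentially"
    using assms(1) by (intro filterlim_compose[OF real_powr_at_top filterlim_real_sequentially]) auto
  then have "\<forall>\<^sub>F m in sequentially. K / c < real m powr (b - a)"
    by (simp add: filterlim_at_top_dense)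
  then obtain m where m: "2 \<le> m" "K / c < real m powr (b - a)"
    by (metis (mono_tags, lifting) eventually_sequentially linear order_trans)
  have "K * real m powr a < (c * real m powr (b - a)) * real m powr a"
    using m assms(2) by (intro mult_strict_right_mono) (auto simp: field_simps)
  also have "\<dots> = c * real m powr b" by (simp flip: powr_add add: mult.assoc)
  finally show thesis using that m(1) by blast
qed

text \<open>
  If a functional \<open>f\<close> had \<open>\<bar>f e\<^sub>n\<bar> \<ge> \<delta>\<close> for infinitely many \<open>n\<close>, then suitable coefficients of modulus at
  most one would align \<open>m\<close> of these values: \<open>f\<close> would take the value \<open>m \<delta>\<close> at a vector of norm at most
  \<open>m\<^bsup>1/s\<^esup>\<close>, which is impossible for large \<open>m\<close> since \<open>1 / s < 1\<close>.
\<close>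

lemma unit_vec_weakly_null:
  assumes s: "1 < s"
  shows "weakly_null (seq_space s :: ('k :: {real_normed_field, banach}, nat \<Rightarrow> 'k) normed_module) unit_vec"
  unfolding weakly_null_def
proof
  let ?X = "seq_space s :: ('k, nat \<Rightarrow> 'k) normed_module"
  fix f :: "(nat \<Rightarrow> 'k) \<Rightarrow> 'k" assume f: "f \<in> operators ?X scalars"
  have s1: "1 \<le> s" using s by simp
  have ns: "normed_space ?X" by (rule normed_space_seq_space[OF s1])
  obtain K where K: "\<And>x. x \<in> carrier ?X \<Longrightarrow> norm (f x) \<le> K * seq_norm s x"
    using operator_norm_bound[OF ns normed_space_scalars f] by (metis scalars_simps(5) seq_space_simps(5))
  show "(\<lambda>n. f (unit_vec n)) \<longlonglongrightarrow> 0"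
  proof (rule ccontr)
    assume "\<not> ?thesis"
    then obtain \<delta> where \<delta>: "0 < \<delta>" "\<And>N. \<exists>n\<ge>N. \<delta> \<le> norm (f (unit_vec n))"
      by (auto simp: LIMSEQ_iff not_less)
    let ?A = "{n. \<delta> \<le> norm (f (unit_vec n))}"
    have inf: "infinite ?A"
      unfolding infinite_nat_iff_unbounded_le using \<delta>(2) by blast
    obtain m :: nat where m: "2 \<le> m" "K * real m powr (1 / s) < \<delta> * real m powr 1"
      using powr_dominated[of "1 / s" 1 \<delta> K] s \<delta>(1) by auto
    obtain G where G: "finite G" "card G = m" "G \<subseteq> ?A"
      using infinite_arbitrarily_large[OF inf] by blast
    \<comment> \<open>Over a general scalar field, division by the value aligns it with \<open>\<delta>\<close>.\<close>
    define a where "a n = of_real \<delta> / f (unit_vec n)" for n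
    define v where "v = (\<lambda>i. \<Sum>n\<in>G. a n * unit_vec n i)"
    have nz: "f (unit_vec n) \<noteq> 0" "norm (a n) \<le> 1" if "n \<in> G" for n
      using G(3) \<delta>(1) that by (auto simp: a_def norm_divide divide_le_eq)
    have v: "v \<in> carrier ?X"
      and nv: "seq_norm s v = (\<Sum>n\<in>G. norm (a n) powr s) powr (1 / s)"
      unfolding v_def using seq_norm_unit_combination[OF G(1), where a = a] by auto
    have "(\<Sum>n\<in>G. norm (a n) powr s) \<le> (\<Sum>n\<in>G. 1)"
      using nz(2) s by (intro sum_mono powr_le1) auto
    then have "seq_norm s v \<le> real m powr (1 / s)"
      unfolding nv using s G(2) by (intro powr_mono2 sum_nonneg) auto
    moreover have "0 \<le> K"
      using order_trans[OF norm_ge_zero K[OF seq_norm_unit_vec(1)[of 0]]]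
      by (simp add: seq_norm_unit_vec(2))
    ultimately have "norm (f v) \<le> K * real m powr (1 / s)"
      using K[OF v] by (meson mult_left_mono order_trans)
    moreover have "f v = of_real (real m * \<delta>)"
    proof -
      have cl: "(\<lambda>i. a n * unit_vec n i) \<in> carrier ?X" for n
        using s1 by (intro seq_space_scale(1) seq_norm_unit_vec) auto
      have "v = (\<Oplus>\<^bsub>?X\<^esub>n\<in>G. (\<lambda>i. a n * unit_vec n i))"
        unfolding v_def by (rule finsum_seq_space[OF s1 G(1) cl, symmetric])
      then have "f v = (\<Sum>n\<in>G. f (\<lambda>i. a n * unit_vec n i))"
        using operators_finsum[OF ns normed_space_scalars f G(1) cl] by (simp add: finsum_scalars[OF G(1)])
      also have "\<dots> = (\<Sum>n\<in>G. a n * f (unit_vec n))"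
      proof (rule sum.cong)
        fix n
        have "(unit_vec n :: nat \<Rightarrow> 'k) \<in> carrier ?X" by (rule seq_norm_unit_vec(1))
        then show "f (\<lambda>i. a n * unit_vec n i) = a n * f (unit_vec n)"
          using f unfolding operators_def by auto
      qed simp
      also have "\<dots> = (\<Sum>n\<in>G. of_real \<delta>)" using nz(1) by (intro sum.cong) (auto simp: a_def)
      finally show ?thesis using G(2) by simp
    qed
    ultimately show False using m(2) \<delta>(1) by (simp add: norm_mult mult.commute)
  qed
qed

section \<open>Upper \<open>\<ell>\<^sub>s\<close>-estimates for weakly null sequences\<close>

text \<open>
  The \<open>\<ell>\<^sub>q\<close>-norm \<open>B\<close> dominates each \<open>\<bar>\<alpha>\<^sub>k\<bar>\<close>, so \<open>\<bar>\<alpha>\<^sub>k\<bar>\<^sup>s \<le> B\<^bsup>s-q\<^esup> \<bar>\<alpha>\<^sub>k\<bar>\<^sup>q\<close>; sum over \<open>k\<close>.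
\<close>

lemma lp_sum_antimono:
  assumes "0 < q" "q \<le> s" "finite F"
  shows "(\<Sum>k\<in>F. norm (\<alpha> k) powr s) powr (1 / s) \<le> (\<Sum>k\<in>F. norm (\<alpha> k) powr q) powr (1 / q)"
proof -
  define B where "B = (\<Sum>k\<in>F. norm (\<alpha> k) powr q) powr (1 / q)"
  have B: "0 \<le> B" "B powr q = (\<Sum>k\<in>F. norm (\<alpha> k) powr q)"
    using assms(1) by (auto simp: B_def powr_powr sum_nonneg)
  have le: "norm (\<alpha> k) \<le> B" if "k \<in> F" for k
  proof -
    have "norm (\<alpha> k) powr q \<le> B powr q"
      unfolding B(2) using assms(3) that by (intro member_le_sum) auto
    then show ?thesis using powr_less_mono2[OF assms(1) B(1), of "norm (\<alpha> k)"] by force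
  qed
  have "(\<Sum>k\<in>F. norm (\<alpha> k) powr s) = (\<Sum>k\<in>F. norm (\<alpha> k) powr (s - q) * norm (\<alpha> k) powr q)"
    by (simp flip: powr_add)
  also have "\<dots> \<le> (\<Sum>k\<in>F. B powr (s - q) * norm (\<alpha> k) powr q)"
    using assms(2) le by (intro sum_mono mult_right_mono powr_mono2) auto
  also have "\<dots> = B powr (s - q) * B powr q" by (simp add: B(2) sum_distrib_left)
  also have "\<dots> = B powr s" by (simp flip: powr_add)
  finally have "(\<Sum>k\<in>F. norm (\<alpha> k) powr s) powr (1 / s) \<le> (B powr s) powr (1 / s)"
    using assms by (intro powr_mono2 sum_nonneg) auto
  then show ?thesis using assms B(1) by (simp add: powr_powr B_def)
qed

text \<open>
  At each coordinate \<open>i\<close> at most one of the vectors contributes, so the \<open>s\<close>-th power of the modulus of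
  the sum is the sum of the \<open>s\<close>-th powers.
\<close>

lemma disjoint_blocks_upper_estimate:
  fixes u :: "nat \<Rightarrow> nat \<Rightarrow> 'k :: {real_normed_field, banach}"
  assumes s: "1 \<le> s" and F: "finite F"
    and u: "\<And>k. k \<in> F \<Longrightarrow> u k \<in> carrier (seq_space s)" "\<And>k. k \<in> F \<Longrightarrow> seq_norm s (u k) \<le> 1"
    and disj: "\<And>k l i. k \<in> F \<Longrightarrow> l \<in> F \<Longrightarrow> u k i \<noteq> 0 \<Longrightarrow> u l i \<noteq> 0 \<Longrightarrow> k = l"
  shows "seq_norm s (\<lambda>i. \<Sum>k\<in>F. \<alpha> k * u k i) \<le> (\<Sum>k\<in>F. norm (\<alpha> k) powr s) powr (1 / s)"
proof (rule seq_norm_leI)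
  fix N
  have "norm (\<Sum>k\<in>F. \<alpha> k * u k i) powr s \<le> (\<Sum>k\<in>F. norm (\<alpha> k) powr s * norm (u k i) powr s)" for i
  proof (cases "\<exists>k\<in>F. u k i \<noteq> 0")
    case True
    then obtain k where k: "k \<in> F" "u k i \<noteq> 0" by blast
    then have "(\<Sum>l\<in>F. \<alpha> l * u l i) = (\<Sum>l\<in>{k}. \<alpha> l * u l i)"
      using disj F by (intro sum.mono_neutral_right) auto
    then have "norm (\<Sum>l\<in>F. \<alpha> l * u l i) powr s = norm (\<alpha> k) powr s * norm (u k i) powr s"
      by (simp add: norm_mult powr_mult)
    then show ?thesis
      using member_le_sum[of k F "\<lambda>k. norm (\<alpha> k) powr s * norm (u k i) powr s"] k(1) F by simp
  next
    case False
    then show ?thesis using s by (simp add: sum_nonneg)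
  qed
  then have "(\<Sum>i<N. norm (\<Sum>k\<in>F. \<alpha> k * u k i) powr s)
      \<le> (\<Sum>i<N. \<Sum>k\<in>F. norm (\<alpha> k) powr s * norm (u k i) powr s)"
    by (intro sum_mono)
  also have "\<dots> = (\<Sum>k\<in>F. norm (\<alpha> k) powr s * (\<Sum>i<N. norm (u k i) powr s))"
    by (subst sum.swap) (simp add: sum_distrib_left)
  also have "\<dots> \<le> (\<Sum>k\<in>F. norm (\<alpha> k) powr s * 1)"
  proof (intro sum_mono mult_left_mono)
    fix k assume "k \<in> F"
    then have "(\<Sum>i<N. norm (u k i) powr s) \<le> seq_norm s (u k) powr s"
      using s u by (intro partial_sum_le_seq_norm) auto
    also have "\<dots> \<le> 1" using s u(2)[OF \<open>k \<in> F\<close>] by (intro powr_le1) (auto simp: seq_norm_nonneg)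
    finally show "(\<Sum>i<N. norm (u k i) powr s) \<le> 1" .
  qed auto
  finally show "(\<Sum>i<N. norm (\<Sum>k\<in>F. \<alpha> k * u k i) powr s)
      \<le> ((\<Sum>k\<in>F. norm (\<alpha> k) powr s) powr (1 / s)) powr s"
    using s by (simp add: powr_powr sum_nonneg)
qed (use s in auto)

text \<open>
  The step of the gliding hump: by coordinatewise convergence some late \<open>x n\<close> is small on the
  coordinates before \<open>j\<close>, and its tail after a suitable \<open>N\<close> is small because it lies in \<open>\<ell>\<^sub>s\<close>. Each of the
  two pieces receives half of the \<open>s\<close>-th power of \<open>e\<close>.
\<close>

lemma essentially_supported_on_block:
  fixes x :: "nat \<Rightarrow> nat \<Rightarrow> 'k :: {real_normed_field, banach}"
  assumes s: "1 \<le> s" and x: "\<And>n. 1 \<le> n \<Longrightarrow> x n \<in> carrier (seq_space s)"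
    and lim: "\<And>i. (\<lambda>n. x n i) \<longlonglongrightarrow> 0" and e: "0 < e"
  shows "\<exists>n>m. \<exists>N\<ge>j. (\<lambda>i. if j \<le> i \<and> i < N then 0 else x n i) \<in> carrier (seq_space s) \<and>
    seq_norm s (\<lambda>i. if j \<le> i \<and> i < N then 0 else x n i) \<le> e"
proof -
  define h where "h = e powr s / 2"
  have h: "0 < h" using e by (simp add: h_def)
  have "(\<lambda>n. \<Sum>i<j. norm (x n i) powr s) \<longlonglongrightarrow> (\<Sum>i<j. norm (0 :: 'k) powr s)"
    using s by (intro tendsto_sum tendsto_powr' tendsto_norm lim tendsto_const) auto
  then have "\<forall>\<^sub>F n in sequentially. (\<Sum>i<j. norm (x n i) powr s) < h"
    using h s by (simp add: order_tendstoD)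
  with eventually_gt_at_top[of m] have "\<forall>\<^sub>F n in sequentially. m < n \<and> (\<Sum>i<j. norm (x n i) powr s) < h"
    by eventually_elim simp
  then obtain n where n: "m < n" "(\<Sum>i<j. norm (x n i) powr s) < h"
    using eventually_sequentially by auto
  have "summable (\<lambda>i. norm (x n i) powr s)" using x[of n] n(1) by simp
  then obtain N0 where N0: "\<And>N K. N \<ge> N0 \<Longrightarrow> norm (\<Sum>i=N..<K. norm (x n i) powr s) < h"
    using h unfolding summable_Cauchy by blast
  define N where "N = max j N0"
  define y where "y = (\<lambda>i. if j \<le> i \<and> i < N then 0 else x n i)"
  have "(\<Sum>i<K. norm (y i) powr s) \<le> e powr s" for K
  proof -
    have "(\<Sum>i<K. norm (y i) powr s) \<le> (\<Sum>i\<in>{..<j} \<union> {N..<K}. norm (y i) powr s)"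
    proof -
      have "(\<Sum>i<K. norm (y i) powr s) = (\<Sum>i\<in>{..<K} \<inter> ({..<j} \<union> {N..<K}). norm (y i) powr s)"
        by (rule sum.mono_neutral_right) (auto simp: y_def)
      also have "\<dots> \<le> (\<Sum>i\<in>{..<j} \<union> {N..<K}. norm (y i) powr s)" by (rule sum_mono2) auto
      finally show ?thesis .
    qed
    also have "\<dots> = (\<Sum>i<j. norm (y i) powr s) + (\<Sum>i=N..<K. norm (y i) powr s)"
      by (rule sum.union_disjoint) (auto simp: N_def)
    also have "\<dots> = (\<Sum>i<j. norm (x n i) powr s) + (\<Sum>i=N..<K. norm (x n i) powr s)"
      by (intro arg_cong2[where f = "(+)"] sum.cong) (auto simp: y_def)
    also have "\<dots> \<le> e powr s" using n(2) N0[of N K] by (auto simp: N_def h_def)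
    finally show ?thesis .
  qed
  then have "y \<in> carrier (seq_space s)" "seq_norm s y \<le> e"
    using s e seq_norm_leI[of s e y] by auto
  moreover have "j \<le> N" by (simp add: N_def)
  ultimately show ?thesis using n(1) unfolding y_def by blast
qed

text \<open>
  The gliding hump: the subsequence splits as \<open>x (r k) = u k + v k\<close> with \<open>u k\<close> supported on disjoint
  blocks \<open>[N k, N (k + 1))\<close> and \<open>\<parallel>v k\<parallel> \<le> 2\<^sup>-\<^sup>k\<close>. With \<open>A\<close> the \<open>\<ell>\<^sub>s\<close>-norm of the coefficients, the blocks
  contribute at most \<open>A\<close> and the errors at most \<open>\<Sum>\<^sub>k 2\<^sup>-\<^sup>k A = 2 A\<close>, whence the constant \<open>3\<close>. The
  sequence starts at \<open>x 1\<close>, whence the bound \<open>1 \<le> r k\<close>.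
\<close>

lemma coordinatewise_null_upper_estimate:
  fixes x :: "nat \<Rightarrow> nat \<Rightarrow> 'k :: {real_normed_field, banach}"
  assumes s: "1 \<le> s"
    and ball: "\<forall>n\<ge>1. x n \<in> carrier (seq_space s) \<and> seq_norm s (x n) \<le> 1"
    and lim: "\<And>i. (\<lambda>n. x n i) \<longlonglongrightarrow> 0"
  shows "\<exists>r :: nat \<Rightarrow> nat. strict_mono r \<and> (\<forall>k. 1 \<le> r k) \<and>
    (\<forall>F \<alpha>. finite F \<longrightarrow> seq_norm s (\<lambda>i. \<Sum>k\<in>F. \<alpha> k * x (r k) i)
      \<le> 3 * (\<Sum>k\<in>F. norm (\<alpha> k) powr s) powr (1 / s))"
proof -
  have x: "x n \<in> carrier (seq_space s)" "seq_norm s (x n) \<le> 1" if "1 \<le> n" for n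
    using ball that by blast+
  \<comment> \<open>A pair \<open>f k\<close> records an index of the sequence and the coordinate where the next block starts.\<close>
  define cut where "cut = (\<lambda>j N n i. if j \<le> i \<and> i < N then 0 else x n i)"
  have "\<exists>nN. fst mj < fst nN \<and> snd mj \<le> snd nN \<and> cut (snd mj) (snd nN) (fst nN) \<in> carrier (seq_space s) \<and>
      seq_norm s (cut (snd mj) (snd nN) (fst nN)) \<le> (1/2) ^ k" for mj :: "nat \<times> nat" and k
  proof -
    obtain n N where "fst mj < n" "snd mj \<le> N" "cut (snd mj) N n \<in> carrier (seq_space s)"
      "seq_norm s (cut (snd mj) N n) \<le> (1/2) ^ k"
      using essentially_supported_on_block[where x = x, OF s x(1) lim, of "(1/2) ^ k" "fst mj" "snd mj"]
      unfolding cut_def by auto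
    then show ?thesis by (intro exI[of _ "(n, N)"]) simp
  qed
  then obtain f where f: "\<And>k. fst (f k) < fst (f (Suc k)) \<and> snd (f k) \<le> snd (f (Suc k)) \<and>
      cut (snd (f k)) (snd (f (Suc k))) (fst (f (Suc k))) \<in> carrier (seq_space s) \<and>
      seq_norm s (cut (snd (f k)) (snd (f (Suc k))) (fst (f (Suc k)))) \<le> (1/2) ^ k"
    using dependent_nat_choice[of "\<lambda>_ _. True" "\<lambda>k mj nN. fst mj < fst nN \<and> snd mj \<le> snd nN \<and>
      cut (snd mj) (snd nN) (fst nN) \<in> carrier (seq_space s) \<and>
      seq_norm s (cut (snd mj) (snd nN) (fst nN)) \<le> (1/2) ^ k"] by blast
  define r where "r k = fst (f (Suc k))" for k
  define N where "N k = snd (f k)" for k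
  define v where "v k = cut (N k) (N (Suc k)) (r k)" for k
  define u where "u k i = (if N k \<le> i \<and> i < N (Suc k) then x (r k) i else 0)" for k i
  have r: "strict_mono r" unfolding r_def by (rule strict_monoI_Suc) (use f in blast)
  have r1: "1 \<le> r k" for k using f[of k] by (simp add: r_def)
  have N: "mono N" unfolding N_def by (rule mono_iff_le_Suc[THEN iffD2]) (use f in blast)
  have v: "v k \<in> carrier (seq_space s)" "seq_norm s (v k) \<le> (1/2) ^ k" for k
    using f[of k] by (simp_all add: v_def N_def r_def)
  have u: "u k \<in> carrier (seq_space s)" "seq_norm s (u k) \<le> 1" for k
  proof -
    have "(\<Sum>i<K. norm (u k i) powr s) \<le> 1 powr s" for K
    proof -
      have "(\<Sum>i<K. norm (u k i) powr s) \<le> (\<Sum>i<K. norm (x (r k) i) powr s)"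
        using s by (intro sum_mono powr_mono2) (auto simp: u_def)
      also have "\<dots> \<le> seq_norm s (x (r k)) powr s"
        using s x(1)[OF r1] by (intro partial_sum_le_seq_norm) auto
      also have "\<dots> \<le> 1 powr s"
        using s x(2)[OF r1] by (intro powr_mono2 seq_norm_nonneg) auto
      finally show ?thesis .
    qed
    then show "u k \<in> carrier (seq_space s)" "seq_norm s (u k) \<le> 1"
      using s seq_norm_leI[of s 1 "u k"] by auto
  qed
  have disj: "k = l" if "u k i \<noteq> 0" "u l i \<noteq> 0" for k l i
  proof -
    have "N k \<le> i" "i < N (Suc k)" "N l \<le> i" "i < N (Suc l)"
      using that by (auto simp: u_def split: if_splits)
    then have "\<not> Suc k \<le> l" "\<not> Suc l \<le> k"
      using monoD[OF N, of "Suc k" l] monoD[OF N, of "Suc l" k] by auto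
    then show ?thesis by simp
  qed
  have bound: "seq_norm s (\<lambda>i. \<Sum>k\<in>F. \<alpha> k * x (r k) i) \<le> 3 * A"
    if F: "finite F" and A: "A = (\<Sum>k\<in>F. norm (\<alpha> k) powr s) powr (1 / s)" for F \<alpha> A
  proof -
    have s0: "0 < s" using s by simp
    have A0: "0 \<le> A" by (simp add: A)
    have le: "norm (\<alpha> k) \<le> A" if "k \<in> F" for k
    proof -
      have "norm (\<alpha> k) powr s \<le> A powr s"
        using s0 that F member_le_sum[of k F "\<lambda>k. norm (\<alpha> k) powr s"] by (simp add: A powr_powr sum_nonneg)
      then show ?thesis using powr_less_mono2[OF s0 A0, of "norm (\<alpha> k)"] by force
    qed
    have cu: "(\<lambda>i. \<alpha> k * u k i) \<in> carrier (seq_space s)" for k by (rule seq_space_scale(1)[OF s0 u(1)])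
    have cv: "(\<lambda>i. \<alpha> k * v k i) \<in> carrier (seq_space s)" for k by (rule seq_space_scale(1)[OF s0 v(1)])
    have split: "\<alpha> k * x (r k) i = \<alpha> k * u k i + \<alpha> k * v k i" for k i
      by (simp add: u_def v_def cut_def)
    have "(\<Sum>k\<in>F. seq_norm s (\<lambda>i. \<alpha> k * v k i)) \<le> (\<Sum>k\<in>F. A * (1/2) ^ k)"
      unfolding seq_space_scale(2)[OF s0 v(1)]
      using le v(2) A0 by (intro sum_mono mult_mono seq_norm_nonneg) auto
    also have "\<dots> = A * (\<Sum>k\<in>F. (1/2) ^ k)" by (simp add: sum_distrib_left)
    also have "\<dots> \<le> A * (\<Sum>k. (1/2) ^ k)"
      using A0 F by (intro mult_left_mono sum_le_suminf summable_geometric) auto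
    also have "\<dots> = 2 * A" by (simp add: suminf_geometric)
    finally have V: "(\<Sum>k\<in>F. seq_norm s (\<lambda>i. \<alpha> k * v k i)) \<le> 2 * A" .
    have U: "seq_norm s (\<lambda>i. \<Sum>k\<in>F. \<alpha> k * u k i) \<le> A"
      unfolding A using F s u disj by (intro disjoint_blocks_upper_estimate) auto
    note sum_u = seq_space_sum[where g = "\<lambda>k i. \<alpha> k * u k i", OF s F cu]
    note sum_v = seq_space_sum[where g = "\<lambda>k i. \<alpha> k * v k i", OF s F cv]
    have "seq_norm s (\<lambda>i. (\<Sum>k\<in>F. \<alpha> k * u k i) + (\<Sum>k\<in>F. \<alpha> k * v k i)) \<le> A + 2 * A"
      using seq_space_add(2)[OF s conjunct1[OF sum_u] conjunct1[OF sum_v]] conjunct2[OF sum_v] U V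
      by linarith
    then show ?thesis by (simp add: split sum.distrib)
  qed
  show ?thesis by (intro exI[of _ r] conjI allI impI r r1 bound refl)
qed

section \<open>Schreier families contain large sets\<close>

text \<open>
  At a successor, a set of the previous family is a union of one block. At a limit ordinal the
  second approximating ordinal is the one to use: the first may be \<open>0\<close>, whose family has no set with
  two elements, but the second is at least \<open>1\<close> and below \<open>\<xi>\<close>. The choice of the index \<open>2\<close> requires
  \<open>2 \<le> min F\<close>.
\<close>

lemma schreier_one_in_schreier:
  assumes Z: "limit_sequences Z" and F: "F \<in> schreier_one" "F \<noteq> {}" "\<And>n. n \<in> F \<Longrightarrow> 2 \<le> n"
    and \<xi>: "1 \<le> \<xi>" "\<xi> \<le> omega1"
  shows "F \<in> schreier Z \<xi>"
proof -
  have "(\<xi>, F) \<in> schreier_rel Z" using \<xi>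
  proof (induction \<xi> rule: less_induct)
    case (less \<xi>)
    have one_le: "1 \<le> \<eta> \<longleftrightarrow> 0 < \<eta>" for \<eta> :: ordinal
      by (simp add: one_ordinal_def ord_suc_le_iff)
    have finF: "finite F" "F \<subseteq> {1..}" using F by (auto simp: schreier_one_def)
    consider "\<xi> = omega1" | "\<xi> < omega1" "is_limit \<xi>" | "\<xi> < omega1" "\<not> is_limit \<xi>"
      using less.prems(2) by force
    then show ?case
    proof cases
      case 1
      then show ?thesis using finF by (simp add: schreier_rel.omega1)
    next
      case 2
      have Z\<xi>: "strict_mono_on {1..} (Z \<xi>)" "\<And>n. 1 \<le> n \<Longrightarrow> Z \<xi> n \<le> \<xi>"
        using Z 2 by (auto simp: limit_sequences_def)
      have "Z \<xi> 1 < Z \<xi> 2" "Z \<xi> 2 < Z \<xi> 3"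
        by (rule strict_mono_onD[OF Z\<xi>(1)]; simp)+
      then have "1 \<le> Z \<xi> 2" "Z \<xi> 2 < \<xi>"
        using Z\<xi>(2)[of 3] zero_le_ordinal[of "Z \<xi> 1"] by (auto simp: one_le)
      then have "(Z \<xi> 2, F) \<in> schreier_rel Z"
        using less.IH less.prems(2) by auto
      then show ?thesis
        using 2 F(3) by (intro schreier_rel.limit[of \<xi> 2]) auto
    next
      case 3
      have "\<xi> \<noteq> 0" using less.prems(1) by (auto simp: one_le)
      then obtain \<zeta> where \<zeta>: "\<xi> = ord_suc \<zeta>" using 3 by (auto simp: is_limit_def)
      have "\<zeta> < \<xi>" unfolding \<zeta> by (rule ord_suc_greater)
      show ?thesis
      proof (cases "\<zeta> = 0")
        case True
        then show ?thesis using F(1) by (simp add: \<zeta> schreier_rel.one flip: one_ordinal_def)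
      next
        case False
        then have "1 \<le> \<zeta>" unfolding one_le using zero_le_ordinal[of \<zeta>] by simp
        then have "(\<zeta>, F) \<in> schreier_rel Z"
          using less.IH \<open>\<zeta> < \<xi>\<close> less.prems(2) by auto
        moreover have "{Min F} \<in> schreier_one"
          using finF F(2) Min_in[OF finF(1) F(2)] by (auto simp: schreier_one_def)
        ultimately have "(ord_suc \<zeta>, \<Union> (set [F])) \<in> schreier_rel Z"
          using \<open>1 \<le> \<zeta>\<close> \<open>\<zeta> < \<xi>\<close> 3 F(2) by (intro schreier_rel.suc) auto
        then show ?thesis by (simp add: \<zeta>)
      qed
    qed
  qed
  then show ?thesis by (simp add: schreier_def)
qed

lemma interval_in_schreier:
  assumes "limit_sequences Z" "1 \<le> \<xi>" "\<xi> \<le> omega1" "2 \<le> m"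
  shows "{m..<2 * m} \<in> schreier Z \<xi>"
proof -
  have "Min {m..<2 * m} = m" using assms(4) by (intro Min_eqI) auto
  then have "{m..<2 * m} \<in> schreier_one" using assms(4) by (auto simp: schreier_one_def)
  then show ?thesis using assms by (intro schreier_one_in_schreier) auto
qed

section \<open>The identity of \<open>\<ell>\<^sub>s\<close>\<close>

text \<open>
  Weak convergence to \<open>0\<close> implies coordinatewise convergence to \<open>0\<close>, so the gliding hump provides a
  subsequence with an upper \<open>\<ell>\<^sub>s\<close>-estimate, and the \<open>\<ell>\<^sub>s\<close>-norm of the coefficients is at most their
  \<open>\<ell>\<^sub>q\<close>-norm. The estimate holds for all finitely supported coefficients, whence for every \<open>\<xi>\<close>.
\<close>

lemma identity_in_WD:
  assumes q: "1 \<le> q" "q \<le> s"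
  shows "(\<lambda>x\<in>carrier (seq_space s). x) \<in>
    WD Z (ereal q) 3 \<xi> (seq_space s :: ('k :: {real_normed_field, banach}, nat \<Rightarrow> 'k) normed_module) (seq_space s)"
proof -
  let ?X = "seq_space s :: ('k, nat \<Rightarrow> 'k) normed_module"
  let ?I = "\<lambda>x\<in>carrier ?X. x"
  have s: "1 \<le> s" using q by simp
  note ns = normed_space_seq_space[OF s]
  have "\<exists>r. strict_mono r \<and> (\<forall>\<alpha>\<in>schreier_coeffs Z \<xi>.
      vnorm ?X (\<Oplus>\<^bsub>?X\<^esub>k\<in>supp \<alpha>. \<alpha> k \<odot>\<^bsub>?X\<^esub> ?I (x (r k))) \<le> (3 + \<epsilon>) * lp_norm (ereal q) \<alpha>)"
    if \<epsilon>: "0 < \<epsilon>" and x: "\<And>n. 1 \<le> n \<Longrightarrow> x n \<in> carrier ?X \<and> vnorm ?X (x n) = 1"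
      and w: "weakly_null ?X x" for \<epsilon> x
  proof -
    have lim: "(\<lambda>n. x n i) \<longlonglongrightarrow> 0" for i
    proof (rule Lim_transform_eventually)
      show "(\<lambda>n. (\<lambda>x\<in>carrier ?X. x i) (x n)) \<longlonglongrightarrow> 0"
        using w coordinate_in_operators[OF s, of i] unfolding weakly_null_def by blast
      show "\<forall>\<^sub>F n in sequentially. (\<lambda>x\<in>carrier ?X. x i) (x n) = x n i"
        using eventually_ge_at_top[of 1] by eventually_elim (use x in simp)
    qed
    have ball: "\<forall>n\<ge>1. x n \<in> carrier ?X \<and> seq_norm s (x n) \<le> 1"
      using x by simp
    obtain r :: "nat \<Rightarrow> nat" where r: "strict_mono r" "\<forall>k. 1 \<le> r k"
      and up: "\<forall>F \<alpha>. finite F \<longrightarrow> seq_norm s (\<lambda>i. \<Sum>k\<in>F. \<alpha> k * x (r k) i)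
        \<le> 3 * (\<Sum>k\<in>F. norm (\<alpha> k) powr s) powr (1 / s)"
      using coordinatewise_null_upper_estimate[OF s ball lim] by blast
    have "vnorm ?X (\<Oplus>\<^bsub>?X\<^esub>k\<in>supp \<alpha>. \<alpha> k \<odot>\<^bsub>?X\<^esub> ?I (x (r k))) \<le> (3 + \<epsilon>) * lp_norm (ereal q) \<alpha>"
      if "\<alpha> \<in> schreier_coeffs Z \<xi>" for \<alpha>
    proof -
      have fin: "finite (supp \<alpha>)" using that by (simp add: schreier_coeffs_def)
      have cl: "x (r k) \<in> carrier ?X" for k using x r(2) by blast
      have I: "?I (x (r k)) = x (r k)" for k using cl[of k] by (simp only: restrict_apply if_True)
      have "(\<Oplus>\<^bsub>?X\<^esub>k\<in>supp \<alpha>. \<alpha> k \<odot>\<^bsub>?X\<^esub> ?I (x (r k))) = (\<lambda>i. \<Sum>k\<in>supp \<alpha>. \<alpha> k * x (r k) i)"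
        unfolding I seq_space_simps(4) using s
        by (intro finsum_seq_space[OF s fin] seq_space_scale(1) cl) auto
      moreover have "3 * (\<Sum>k\<in>supp \<alpha>. norm (\<alpha> k) powr s) powr (1 / s) \<le> 3 * lp_norm (ereal q) \<alpha>"
        using lp_sum_antimono[OF _ q(2) fin, of \<alpha>] q(1) by (simp add: lp_norm_def)
      moreover have "3 * lp_norm (ereal q) \<alpha> \<le> (3 + \<epsilon>) * lp_norm (ereal q) \<alpha>"
        using \<epsilon> by (intro mult_right_mono) (auto simp: lp_norm_def)
      ultimately show ?thesis using up[rule_format, OF fin, of \<alpha>] by simp
    qed
    then show ?thesis using r(1) by blast
  qed
  then show ?thesis
    unfolding WD_def by (intro CollectI conjI allI impI identity_in_operators[OF ns]) (elim conjE, blast)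
qed

text \<open>
  The formula includes \<open>p = \<infinity>\<close>, as \<open>real_of_ereal\<close> sends \<open>\<infinity>\<close> to \<open>0\<close> and \<open>1 / 0 = 0\<close>: the exponent
  is then \<open>0\<close> and the value \<open>1\<close>.
\<close>

lemma lp_norm_indicator:
  assumes "finite F" "F \<noteq> {}"
  shows "lp_norm p (\<lambda>k. of_bool (k \<in> F) :: 'k :: real_normed_field) = real (card F) powr (1 / real_of_ereal p)"
proof (cases "p = \<infinity>")
  case True
  have "(SUP k. norm (of_bool (k \<in> F) :: 'k)) = 1"
    using assms(2) by (intro cSup_eq_maximum) (auto simp: image_iff of_bool_def split: if_splits)
  then show ?thesis using True assms by (simp add: lp_norm_def)
next
  case False
  have "supp (\<lambda>k. of_bool (k \<in> F) :: 'k) = F" by (auto simp: supp_def)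
  then show ?thesis using False by (simp add: lp_norm_def)
qed

text \<open>
  An operator \<open>S\<close> at distance less than \<open>1/2\<close> from the identity satisfies \<open>\<parallel>S v\<parallel> \<ge> \<parallel>v\<parallel> / 2\<close>. For \<open>v\<close> a sum of
  \<open>m\<close> unit vectors this is \<open>m\<^bsup>1/s\<^esup> / 2\<close>. If \<open>S\<close> were of class \<open>\<W>\<D>\<close> for \<open>p\<close> with constant \<open>C\<close>, then some
  subsequence of the unit vectors, summed over \<open>{m..<2 * m}\<close>, would give \<open>\<parallel>S v\<parallel> \<le> (C + 1) m\<^bsup>1/p\<^esup>\<close>. This
  fails for large \<open>m\<close>, as \<open>1 / p < 1 / s\<close>.
\<close>

lemma identity_notin_WD_closure:
  assumes s: "1 < s" and sp: "ereal s < p"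
    and Z: "limit_sequences Z" and \<xi>: "1 \<le> \<xi>" "\<xi> \<le> omega1"
  shows "(\<lambda>x\<in>carrier (seq_space s). x) \<notin>
    WD_closure Z p \<xi> (seq_space s :: ('k :: {real_normed_field, banach}, nat \<Rightarrow> 'k) normed_module) (seq_space s)"
proof
  let ?X = "seq_space s :: ('k, nat \<Rightarrow> 'k) normed_module"
  let ?I = "\<lambda>x\<in>carrier ?X. x"
  have s1: "1 \<le> s" using s by simp
  note ns = normed_space_seq_space[OF s1]
  interpret X: normed_space ?X by (rule ns)
  interpret L: Metric_space "operators ?X ?X" "opdist ?X ?X" by (rule Metric_space_opdist[OF ns ns])
  assume "?I \<in> WD_closure Z p \<xi> ?X ?X"
  then have "\<forall>e>0. \<exists>S\<in>WD_inf Z p \<xi> ?X ?X. S \<in> L.mball ?I e"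
    unfolding WD_closure_def norm_closure_def L.metric_closure_of by blast
  then obtain S where "S \<in> WD_inf Z p \<xi> ?X ?X" and "S \<in> L.mball ?I (1/2)"
    by (meson half_gt_zero_iff zero_less_one)
  then obtain C where C: "0 \<le> C" and S: "S \<in> WD Z p C \<xi> ?X ?X" and close: "opdist ?X ?X ?I S < 1/2"
    unfolding WD_inf_def L.in_mball by blast
  have So: "S \<in> operators ?X ?X" using S by (simp add: WD_def)
  have e_cl: "(unit_vec n :: nat \<Rightarrow> 'k) \<in> carrier ?X" for n by (rule seq_norm_unit_vec(1))
  have unit: "\<forall>n\<ge>1. (unit_vec n :: nat \<Rightarrow> 'k) \<in> carrier ?X \<and> vnorm ?X (unit_vec n) = 1"
    using seq_norm_unit_vec[where 'k = 'k] by simp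
  have "\<exists>r. strict_mono r \<and> (\<forall>\<alpha>\<in>schreier_coeffs Z \<xi>.
      vnorm ?X (\<Oplus>\<^bsub>?X\<^esub>k\<in>supp \<alpha>. \<alpha> k \<odot>\<^bsub>?X\<^esub> S (unit_vec (r k))) \<le> (C + 1) * lp_norm p \<alpha>)"
    by (rule S[unfolded WD_def, THEN CollectD, THEN conjunct2, THEN spec[of _ 1], THEN mp, OF zero_less_one,
          THEN spec[of _ unit_vec], THEN mp, OF conjI[OF unit unit_vec_weakly_null[OF s]]])
  then obtain r where r: "strict_mono r" and up: "\<forall>\<alpha>\<in>schreier_coeffs Z \<xi>.
      vnorm ?X (\<Oplus>\<^bsub>?X\<^esub>k\<in>supp \<alpha>. \<alpha> k \<odot>\<^bsub>?X\<^esub> S (unit_vec (r k))) \<le> (C + 1) * lp_norm p \<alpha>"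
    by (elim exE conjE)
  have "1 / real_of_ereal p < 1 / s"
    using s sp by (cases p) (auto intro!: divide_strict_left_mono)
  then obtain m where m: "2 \<le> m"
    "(C + 1) * real m powr (1 / real_of_ereal p) < 1/2 * real m powr (1 / s)"
    using powr_dominated[of "1 / real_of_ereal p" "1 / s" "1/2" "C + 1"] by auto
  define F where "F = {m..<2 * m}"
  define \<alpha> :: "nat \<Rightarrow> 'k" where "\<alpha> k = of_bool (k \<in> F)" for k
  have F: "finite F" "card F = m" "F \<noteq> {}" using m(1) by (auto simp: F_def)
  have supp: "supp \<alpha> = F" by (auto simp: supp_def \<alpha>_def)
  have "\<alpha> \<in> schreier_coeffs Z \<xi>"
    using interval_in_schreier[OF Z \<xi> m(1)] F(1) by (simp add: schreier_coeffs_def supp F_def)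
  note up = bspec[OF up this, unfolded supp]
  define w where "w k = \<alpha> k \<odot>\<^bsub>?X\<^esub> unit_vec (r k)" for k
  define v where "v = (\<Oplus>\<^bsub>?X\<^esub>k\<in>F. w k)"
  have w_cl: "w k \<in> carrier ?X" for k
    unfolding w_def by (rule X.smult_closed[OF _ e_cl]) simp
  have v_cl: "v \<in> carrier ?X" unfolding v_def using w_cl by (intro X.M.finsum_closed) blast
  have "S v = (\<Oplus>\<^bsub>?X\<^esub>k\<in>F. S (w k))"
    unfolding v_def by (rule operators_finsum[OF ns ns So F(1) w_cl])
  also have "\<dots> = (\<Oplus>\<^bsub>?X\<^esub>k\<in>F. \<alpha> k \<odot>\<^bsub>?X\<^esub> S (unit_vec (r k)))"
  proof -
    have "S (w k) = \<alpha> k \<odot>\<^bsub>?X\<^esub> S (unit_vec (r k))" for k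
      using So e_cl[of "r k"] unfolding operators_def w_def by blast
    then show ?thesis by simp
  qed
  finally have upper: "vnorm ?X (S v) \<le> (C + 1) * real m powr (1 / real_of_ereal p)"
    using up lp_norm_indicator[OF F(1,3), of p, where 'k = 'k] F(2) unfolding \<alpha>_def by simp
  have norm_v: "vnorm ?X v = real m powr (1 / s)"
  proof -
    have inj: "inj_on r F" using r strict_mono_imp_inj_on by blast
    have "v = (\<lambda>i. \<Sum>k\<in>F. w k i)" unfolding v_def by (rule finsum_seq_space[OF s1 F(1) w_cl])
    also have "\<dots> = (\<lambda>i. \<Sum>k\<in>F. 1 * unit_vec (r k) i)" by (simp add: w_def \<alpha>_def)
    also have "\<dots> = (\<lambda>i. \<Sum>n\<in>r ` F. 1 * unit_vec n i)" by (simp add: sum.reindex[OF inj])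
    finally show ?thesis
      using seq_norm_unit_combination(2)[of "r ` F" s "\<lambda>_. 1 :: 'k"] F(1,2)
      by (simp add: card_image[OF inj])
  qed
  have Sv_cl: "S v \<in> carrier ?X" using So v_cl unfolding operators_def by blast
  have "?I v = v" using v_cl by (simp only: restrict_apply if_True)
  then have "vnorm ?X (v \<ominus>\<^bsub>?X\<^esub> S v) \<le> opdist ?X ?X ?I S * vnorm ?X v"
    using operator_diff_le_opdist[OF ns ns identity_in_operators[OF ns] So v_cl] by simp
  also have "\<dots> \<le> 1/2 * vnorm ?X v"
    using close X.vnorm_nonneg[OF v_cl] by (intro mult_right_mono) auto
  finally have "vnorm ?X (v \<ominus>\<^bsub>?X\<^esub> S v) \<le> 1/2 * vnorm ?X v" .
  moreover have "vnorm ?X v \<le> vnorm ?X (v \<ominus>\<^bsub>?X\<^esub> S v) + vnorm ?X (S v)"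
    using X.minus_triangle[OF v_cl Sv_cl X.M.zero_closed]
    by (simp only: X.minus_zero_right[OF v_cl] X.minus_zero_right[OF Sv_cl])
  ultimately show False using upper norm_v m(2) by simp
qed

theorem proposition3p1:
  fixes Z :: "ordinal \<Rightarrow> nat \<Rightarrow> ordinal" and \<xi> :: ordinal and p q :: ereal
  assumes "limit_sequences Z"
    and "1 \<le> \<xi>" and "\<xi> \<le> omega1"
    and "1 \<le> q" and "q < p" and "p \<le> \<infinity>"
  shows "\<exists>(X :: ('k :: {real_normed_field, banach}, nat \<Rightarrow> 'k) normed_module)
      (Y :: ('k, nat \<Rightarrow> 'k) normed_module).
    banach_space X \<and> banach_space Y \<and>
    WD_closure Z p \<xi> X Y \<noteq> WD_closure Z q \<xi> X Y"
proof -
  \<comment> \<open>An exponent strictly between \<open>q\<close> and \<open>p\<close> is finite and greater than \<open>1\<close>, also for \<open>q = 1\<close> or \<open>p = \<infinity>\<close>.\<close>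
  obtain s where s: "q < ereal s" "ereal s < p" using ereal_dense2[OF \<open>q < p\<close>] by blast
  obtain q' where q': "q = ereal q'" using \<open>1 \<le> q\<close> \<open>q < p\<close> by (cases q) auto
  have q1: "1 \<le> q'" and qs: "q' < s" using \<open>1 \<le> q\<close> s(1) by (auto simp: q' one_ereal_def)
  let ?X = "seq_space s :: ('k, nat \<Rightarrow> 'k) normed_module"
  let ?I = "\<lambda>x\<in>carrier ?X. x"
  have s1: "1 < s" using q1 qs by simp
  note ns = normed_space_seq_space[OF less_imp_le[OF s1], where 'k = 'k]
  interpret L: Metric_space "operators ?X ?X" "opdist ?X ?X" by (rule Metric_space_opdist[OF ns ns])
  have "?I \<in> WD_inf Z q \<xi> ?X ?X"
    using identity_in_WD[of q' s Z \<xi>] q1 qs unfolding WD_inf_def q' by (intro UN_I[of 3]) auto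
  moreover have "WD_inf Z q \<xi> ?X ?X \<subseteq> L.mtopology closure_of WD_inf Z q \<xi> ?X ?X"
    by (rule closure_of_subset) (auto simp: WD_inf_def WD_def)
  ultimately have "?I \<in> WD_closure Z q \<xi> ?X ?X"
    unfolding WD_closure_def norm_closure_def by blast
  moreover have "?I \<notin> WD_closure Z p \<xi> ?X ?X"
    using s1 s(2) assms(1-3) by (rule identity_notin_WD_closure)
  ultimately have "WD_closure Z p \<xi> ?X ?X \<noteq> WD_closure Z q \<xi> ?X ?X" by blast
  moreover have "banach_space ?X" using s1 by (intro banach_space_seq_space) simp
  ultimately show ?thesis by blast
qed

end
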